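(* Let $G$ be a graph on $n\ge 5432$ vertices such that $\lambda(G)\ge \lambda\bigl(K^{+}_{\lceil \frac n2\rceil,\lfloor \frac n2\rfloor}\bigr)$. Then $G$ has at least $2\lfloor \frac n2\rfloor+1$ triangular edges, with equality if and only if $G=K^{+}_{\lceil \frac n2\rceil,\lfloor \frac n2\rfloor}$.
   Context: All graphs are finite and simple. $\lambda(G)$ denotes the spectral radius of $G$, i.e. the largest eigenvalue of its adjacency matrix. An edge of $G$ is called triangular if it is contained in a triangle of $G$. $K_{a,b}^{+}$ denotes the graph obtained from the complete bipartite graph $K_{a,b}$ by adding one edge inside the vertex part of size $a$; thus $K^{+}_{\lceil \frac n2\rceil,\lfloor \frac n2\rfloor}$ is obtained from $K_{\lceil \frac n2\rceil,\lfloor \frac n2\rfloor}$ by adding an edge inside the part of size $\lceil n/2\rceil$. Equality of graphs means isomorphism. *)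

theory Defs
  imports
    "Jordan_Normal_Form.Spectral_Radius"
    "Graph_Theory.Pair_Digraph"
    "Graph_Theory.Digraph_Isomorphism"
    "Graph_Theory.Kuratowski"
begin

text \<open>
  Finite simple graphs are the \<^locale>\<open>pair_graph\<close>s: an undirected edge \<open>uv\<close> is the
  pair of arcs \<open>(u,v)\<close>, \<open>(v,u)\<close>. Edges are therefore counted as two-element vertex sets, not as arcs.
\<close>

definition is_triangle :: "'a pair_pre_digraph \<Rightarrow> 'a \<Rightarrow> 'a \<Rightarrow> 'a \<Rightarrow> bool" where
  "is_triangle G u v w \<longleftrightarrow> (u, v) \<in> parcs G \<and> (v, w) \<in> parcs G \<and> (w, u) \<in> parcs G"

definition triangular_edges :: "'a pair_pre_digraph \<Rightarrow> 'a set set" where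
  "triangular_edges G = {{u, v} | u v. (u, v) \<in> parcs G \<and> (\<exists>w. is_triangle G u v w)}"

text \<open>
  The adjacency matrix depends on an enumeration of the vertices, which is chosen arbitrarily; by
  \<open>eigenvalue_adjacency_mat_iff\<close> below, its eigenvalues do not depend on the choice.
\<close>

definition vertex_enum :: "'a pair_pre_digraph \<Rightarrow> nat \<Rightarrow> 'a" where
  "vertex_enum G = (SOME e. bij_betw e {0..<card (pverts G)} (pverts G))"

definition adjacency_mat :: "'a pair_pre_digraph \<Rightarrow> real mat" where
  "adjacency_mat G = mat (card (pverts G)) (card (pverts G))
     (\<lambda>(i, j). if (vertex_enum G i, vertex_enum G j) \<in> parcs G then 1 else 0)"

text \<open>
  The largest real eigenvalue. For a graph with at least one vertex the real spectrum is finite and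
  nonempty, since the matrix is symmetric.
\<close>

definition graph_spectral_radius :: "'a pair_pre_digraph \<Rightarrow> real" where
  "graph_spectral_radius G = Max (spectrum (adjacency_mat G))"

definition complete_bipartite :: "nat \<Rightarrow> nat \<Rightarrow> nat pair_pre_digraph" where
  "complete_bipartite a b =
     \<lparr> pverts = {..<a + b},
       parcs = {..<a} \<times> {a..<a + b} \<union> {a..<a + b} \<times> {..<a} \<rparr>"

text \<open>
  \<open>K\<^sub>a\<^sub>,\<^sub>b\<^sup>+\<close> makes sense for \<open>a \<ge> 2\<close> only: the added edge joins the vertices 0 and 1 of the part \<open>{..<a}\<close>.
\<close>

definition complete_bipartite_plus :: "nat \<Rightarrow> nat \<Rightarrow> nat pair_pre_digraph" where
  "complete_bipartite_plus a b =
     \<lparr> pverts = pverts (complete_bipartite a b),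
       parcs = parcs (complete_bipartite a b) \<union> {(0, 1), (1, 0)} \<rparr>"

lemma complete_bipartite_digraph_complete_bipartite:
  "complete_bipartite_digraph a b (with_proj (complete_bipartite a b))"
  unfolding complete_bipartite_digraph_pair_def complete_bipartite_def
  by (simp, rule exI[of _ "{..<a}"], rule exI[of _ "{a..<a + b}"]) auto

lemma pair_graph_complete_bipartite_plus:
  assumes "2 \<le> a"
  shows "pair_graph (complete_bipartite_plus a b)"
  using assms
  by unfold_locales
    (auto simp: complete_bipartite_plus_def complete_bipartite_def symmetric_def intro!: symI)

lemma bij_betw_vertex_enum:
  assumes "finite (pverts G)"
  shows "bij_betw (vertex_enum G) {0..<card (pverts G)} (pverts G)"
  unfolding vertex_enum_def using ex_bij_betw_nat_finite[OF assms] by (rule someI_ex)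

lemma eigenvalue_adjacency_mat_iff:
  fixes k :: real
  assumes "pair_graph G"
  shows "eigenvalue (adjacency_mat G) k \<longleftrightarrow>
    (\<exists>x. (\<exists>v \<in> pverts G. x v \<noteq> 0) \<and>
         (\<forall>v \<in> pverts G. (\<Sum>w | (v, w) \<in> parcs G. x w) = k * x v))"
proof -
  interpret pair_graph G by fact
  define n where "n = card (pverts G)"
  define e where "e = vertex_enum G"
  have e: "bij_betw e {0..<n} (pverts G)"
    unfolding e_def n_def by (rule bij_betw_vertex_enum) (rule pair_finite_verts)
  have sum_eq: "(\<Sum>w | (v, w) \<in> parcs G. x w)
      = (\<Sum>j = 0..<n. (if (v, e j) \<in> parcs G then 1 else 0) * x (e j))" for v and x :: "'a \<Rightarrow> real"
  proof -
    have "(\<Sum>j = 0..<n. (if (v, e j) \<in> parcs G then 1 else 0) * x (e j))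
        = (\<Sum>w \<in> pverts G. (if (v, w) \<in> parcs G then 1 else 0) * x w)"
      using sum.reindex_bij_betw[OF e, of "\<lambda>w. (if (v, w) \<in> parcs G then 1 else 0) * x w"] by simp
    also have "\<dots> = (\<Sum>w \<in> pverts G. if (v, w) \<in> parcs G then x w else 0)"
      by (rule sum.cong) auto
    also have "\<dots> = (\<Sum>w | w \<in> pverts G \<and> (v, w) \<in> parcs G. x w)"
      by (rule sum.inter_filter[symmetric]) (rule pair_finite_verts)
    also have "{w. w \<in> pverts G \<and> (v, w) \<in> parcs G} = {w. (v, w) \<in> parcs G}"
      using in_arcsD2 by auto
    finally show ?thesis by simp
  qed
  have mult: "(adjacency_mat G *\<^sub>v vec n (x \<circ> e)) $ i = (\<Sum>w | (e i, w) \<in> parcs G. x w)"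
    if "i < n" for i and x :: "'a \<Rightarrow> real"
    using that unfolding sum_eq adjacency_mat_def n_def[symmetric] e_def[symmetric]
    by (auto simp: scalar_prod_def intro!: sum.cong)
  have dim: "dim_row (adjacency_mat G) = n"
    by (simp add: adjacency_mat_def n_def)
  have ev: "eigenvector (adjacency_mat G) (vec n (x \<circ> e)) k \<longleftrightarrow>
      (\<exists>v \<in> pverts G. x v \<noteq> 0) \<and>
      (\<forall>v \<in> pverts G. (\<Sum>w | (v, w) \<in> parcs G. x w) = k * x v)" for x
  proof -
    have V: "pverts G = e ` {0..<n}" using e by (simp add: bij_betw_def)
    have "vec n (x \<circ> e) \<noteq> 0\<^sub>v n \<longleftrightarrow> (\<exists>v \<in> pverts G. x v \<noteq> 0)"
      unfolding V by (auto simp: vec_eq_iff)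
    moreover have "adjacency_mat G *\<^sub>v vec n (x \<circ> e) = k \<cdot>\<^sub>v vec n (x \<circ> e) \<longleftrightarrow>
        (\<forall>v \<in> pverts G. (\<Sum>w | (v, w) \<in> parcs G. x w) = k * x v)"
      unfolding V using dim mult by (auto simp: vec_eq_iff simp del: index_mult_mat_vec)
    ultimately show ?thesis unfolding eigenvector_def dim by simp
  qed
  show ?thesis
  proof
    assume "eigenvalue (adjacency_mat G) k"
    then obtain y where y: "eigenvector (adjacency_mat G) y k" unfolding eigenvalue_def by blast
    define x where "x v = y $ the_inv_into {0..<n} e v" for v
    have "y = vec n (x \<circ> e)"
      using y e unfolding eigenvector_def dim x_def
      by (auto simp: vec_eq_iff the_inv_into_f_f bij_betw_def)
    with y ev show "\<exists>x. (\<exists>v \<in> pverts G. x v \<noteq> 0) \<and>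
        (\<forall>v \<in> pverts G. (\<Sum>w | (v, w) \<in> parcs G. x w) = k * x v)" by metis
  next
    assume "\<exists>x. (\<exists>v \<in> pverts G. x v \<noteq> 0) \<and>
        (\<forall>v \<in> pverts G. (\<Sum>w | (v, w) \<in> parcs G. x w) = k * x v)"
    then show "eigenvalue (adjacency_mat G) k" unfolding eigenvalue_def using ev by blast
  qed
qed

end

theory Submission
  imports Defs "HOL-Analysis.Analysis"
begin

text \<open>
  Suppose that there are at most \<open>2b + 1\<close> triangular edges, \<open>b = \<lfloor>n/2\<rfloor>\<close>. Let \<open>x\<close> be the Perron vector,
  with maximum \<open>1\<close> at \<open>u\<close>. Counting walks of length two from \<open>u\<close>, and noting that edges inside the
  neighbourhood of \<open>u\<close> are triangular, shows that the neighbourhood spans a cut with \<open>n\<^sup>2/4 - O(n)\<close>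
  edges. So a maximum cut \<open>(A, B)\<close> is nearly balanced and misses \<open>O(n)\<close> cross edges, and inner degrees
  are \<open>O(\<surd>n)\<close>. Summing the eigenvalue equation over \<open>A\<close> and over \<open>B\<close> compares the weight of the
  inner edges with that of the missing cross edges. A vertex with many missing cross edges would lose
  more than it can gain, so there is none; then every inner edge has so many common neighbours that only
  one inner edge is possible, and it does not make up for even one missing cross edge. Hence the graph
  is \<open>K\<^sup>+\<close> on the parts \<open>A\<close> and \<open>B\<close>; the spectral condition gives \<open>|B| \<ge> b\<close> and the number of
  triangular edges gives \<open>|B| \<le> b\<close>.
\<close>

section \<open>Counting arcs by their tails\<close>

lemma sum_Image:
  fixes f :: "'b \<Rightarrow> 'c::comm_monoid_add"
  assumes "finite R" "finite A"
  shows "(\<Sum>v\<in>A. \<Sum>w\<in>R `` {v}. f w) = (\<Sum>p\<in>R \<inter> A \<times> UNIV. f (snd p))"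
proof -
  have "(\<Sum>v\<in>A. \<Sum>w\<in>R `` {v}. f w) = (\<Sum>p\<in>Sigma A (\<lambda>v. R `` {v}). f (snd p))"
    using assms by (subst sum.Sigma) (auto simp: case_prod_beta finite_Image)
  also have "Sigma A (\<lambda>v. R `` {v}) = R \<inter> A \<times> UNIV" by auto
  finally show ?thesis .
qed

lemma card_Image:
  assumes "finite R" "finite A"
  shows "card (R \<inter> A \<times> UNIV) = (\<Sum>v\<in>A. card (R `` {v}))"
  using sum_Image[OF assms, of "\<lambda>_. 1 :: nat"] by simp

lemma card_swap: "card (prod.swap ` R) = card R"
  by (intro card_image inj_onI) (metis swap_swap)

section \<open>The normalised Perron vector and first estimates\<close>

text \<open>The vector \<open>x\<close> is scaled to have maximum \<open>1\<close>, attained at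
  \<open>u\<close>. The facts \<open>l_sq\<close> and \<open>l_plus\<close> encode that
  \<open>l\<close> is at least the root \<open>r\<close> of
  \<open>(r^2 - m) * (r - 1) = 2 * b\<close> beyond \<open>sqrt m\<close>, where
  \<open>m = (n - b) * b\<close>: the eigenvalue equation of the extremal graph. Triangular edges
  are counted as arcs, so \<open>4 * b + 2\<close> is twice \<open>2 * b + 1\<close>.\<close>

locale perron_graph =
  fixes V :: "'a set" and E :: "('a \<times> 'a) set" and x :: "'a \<Rightarrow> real" and l :: real
    and u :: 'a and n b :: nat
  assumes finite_V: "finite V"
    and E_sub: "E \<subseteq> V \<times> V"
    and E_sym: "(v, w) \<in> E \<Longrightarrow> (w, v) \<in> E"
    and E_irrefl: "(v, v) \<notin> E"
    and x_nonneg: "v \<in> V \<Longrightarrow> 0 \<le> x v"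
    and x_le_1: "v \<in> V \<Longrightarrow> x v \<le> 1"
    and u_in: "u \<in> V"
    and x_u: "x u = 1"
    and eigen: "v \<in> V \<Longrightarrow> l * x v = (\<Sum>w\<in>E `` {v}. x w)"
    and card_V: "card V = n"
    and n_large: "5432 \<le> n"
    and b_def: "b = n div 2"
    and l_pos: "0 < l"
    and l_sq: "real ((n - b) * b) < l^2"
    and l_plus: "2 * real b \<le> (l^2 - real ((n - b) * b)) * (l - 1)"
    and few_triangular: "card {(v, w) \<in> E. \<exists>z. (w, z) \<in> E \<and> (z, v) \<in> E} \<le> 4 * b + 2"
begin

definition tri :: "('a \<times> 'a) set" where
  "tri = {(v, w) \<in> E. \<exists>z. (w, z) \<in> E \<and> (z, v) \<in> E}"

lemma finite_E: "finite E"
  using finite_V E_sub finite_subset by blast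

lemma finite_tri: "finite tri"
  by (rule finite_subset[OF _ finite_E]) (auto simp: tri_def)

lemma nb_sub: "E `` {v} \<subseteq> V" using E_sub by auto

lemma tri_sym: "(v, w) \<in> tri \<Longrightarrow> (w, v) \<in> tri"
  unfolding tri_def using E_sym by blast

lemma triI: "(v, w) \<in> E \<Longrightarrow> (v, z) \<in> E \<Longrightarrow> (w, z) \<in> E \<Longrightarrow> (v, w) \<in> tri"
  unfolding tri_def using E_sym by blast

lemma card_tri: "real (card tri) \<le> 2 * real n + 2"
proof -
  have "card tri \<le> 4 * b + 2" unfolding tri_def by (rule few_triangular)
  moreover have "2 * b \<le> n" by (simp add: b_def)
  ultimately show ?thesis by linarith
qed

lemma balanced_product: "real n ^ 2 / 4 - 1 / 4 \<le> real ((n - b) * b)"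
proof (cases "even n")
  case True
  then obtain k where "n = 2 * k" by blast
  then show ?thesis by (simp add: b_def power2_eq_square)
next
  case False
  then obtain k where k: "n = 2 * k + 1" using oddE by blast
  then have "b = k" "n - b = k + 1" by (auto simp: b_def)
  then show ?thesis by (simp add: k power2_eq_square algebra_simps)
qed

lemma l_sq_ge: "real n ^ 2 / 4 - 1 / 4 \<le> l^2"
  using balanced_product l_sq by linarith

lemma l_ge: "real n / 2 - 1 \<le> l"
proof (rule ccontr)
  assume "\<not> ?thesis"
  then have "l^2 \<le> (real n / 2 - 1)^2" using l_pos by (intro power_mono) auto
  then show False using l_sq_ge n_large by (simp add: power2_eq_square algebra_simps)
qed

lemma sum_nb_card: "v \<in> V \<Longrightarrow> (\<Sum>w\<in>E `` {v}. x w) \<le> real (card (E `` {v}))"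
  using sum_bounded_above[of "E `` {v}" x 1] x_le_1 nb_sub by (auto simp: subset_iff)

text \<open>Arcs inside the neighbourhood of a vertex are triangular.\<close>

lemma large_neighbourhood_cut:
  "l^2 - 2 * real n - 2 \<le> real (card (E \<inter> E `` {u} \<times> (V - E `` {u})))"
proof -
  let ?N = "E `` {u}"
  have fN: "finite ?N" using finite_V nb_sub finite_subset by blast
  have "l^2 = l * (l * x u)" by (simp add: x_u power2_eq_square)
  also have "\<dots> = (\<Sum>v\<in>?N. l * x v)" by (simp add: eigen[OF u_in] sum_distrib_left)
  also have "\<dots> = (\<Sum>v\<in>?N. \<Sum>w\<in>E `` {v}. x w)"
    using E_sub by (intro sum.cong refl eigen) auto
  also have "\<dots> \<le> (\<Sum>v\<in>?N. real (card (E `` {v})))"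
    using nb_sub[of u] by (intro sum_mono sum_nb_card) auto
  also have "\<dots> = real (card (E \<inter> ?N \<times> UNIV))"
    using card_Image[OF finite_E fN] by simp
  also have "E \<inter> ?N \<times> UNIV = (E \<inter> ?N \<times> ?N) \<union> (E \<inter> ?N \<times> (V - ?N))" using E_sub by auto
  also have "real (card \<dots>) \<le> real (card (E \<inter> ?N \<times> ?N)) + real (card (E \<inter> ?N \<times> (V - ?N)))"
    by (metis card_Un_le of_nat_add of_nat_le_iff)
  also have "card (E \<inter> ?N \<times> ?N) \<le> card tri"
    by (intro card_mono finite_tri) (auto intro: triI E_sym)
  finally show ?thesis using card_tri by linarith
qed

text \<open>Both bounds sum the triangular degrees over \<open>X\<close>. In the second, at most
  \<open>|X|^2\<close> of these arcs stay in \<open>X\<close>; each other one has a reverse that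
  starts outside \<open>X\<close>, and so counts twice.\<close>

lemma card_Image_ge:
  assumes "X \<subseteq> V" "\<And>v. v \<in> X \<Longrightarrow> D \<le> real (card (tri `` {v}))"
  shows "real (card X) * D \<le> real (card tri)"
    and "2 * real (card X) * (D - real (card X)) \<le> real (card tri)"
proof -
  have fX: "finite X" using assms finite_V finite_subset by blast
  have "real (card X) * D = (\<Sum>v\<in>X. D)" by simp
  also have "\<dots> \<le> (\<Sum>v\<in>X. real (card (tri `` {v})))" by (intro sum_mono assms)
  also have "\<dots> = real (card (tri \<inter> X \<times> UNIV))" using card_Image[OF finite_tri fX] by simp
  finally have 1: "real (card X) * D \<le> real (card (tri \<inter> X \<times> UNIV))" .
  also have "card (tri \<inter> X \<times> UNIV) \<le> card tri" by (intro card_mono finite_tri) auto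
  finally show "real (card X) * D \<le> real (card tri)" by simp
  let ?O = "tri \<inter> X \<times> (- X)"
  have "card (tri \<inter> X \<times> UNIV) \<le> card (?O \<union> X \<times> X)"
    by (intro card_mono) (auto simp: fX finite_tri)
  also have "\<dots> \<le> card ?O + card (X \<times> X)" by (rule card_Un_le)
  finally have 2: "real (card X) * D \<le> real (card ?O) + real (card X) * real (card X)"
    using 1 by (simp add: card_cartesian_product flip: of_nat_mult of_nat_add)
  have "2 * card ?O = card ?O + card (prod.swap ` ?O)" by (simp add: card_swap)
  also have "\<dots> = card (?O \<union> prod.swap ` ?O)"
    by (intro card_Un_disjoint[symmetric]) (auto simp: finite_tri)
  also have "\<dots> \<le> card tri" by (intro card_mono finite_tri) (auto intro: tri_sym)
  finally have "2 * real (card ?O) \<le> real (card tri)" by linarith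
  with 2 show "2 * real (card X) * (D - real (card X)) \<le> real (card tri)"
    by (simp add: algebra_simps)
qed

end

section \<open>Structure of a maximum cut\<close>

locale max_cut = perron_graph V E x l u n b
  for V :: "'a set" and E x l u n b +
  fixes A B :: "'a set"
  assumes cut: "A \<union> B = V" "A \<inter> B = {}"
    and max: "W \<subseteq> V \<Longrightarrow> card (E \<inter> W \<times> (V - W)) \<le> card (E \<inter> A \<times> B)"
begin

text \<open>The symmetry of the two sides transfers every fact about \<open>A\<close> to
  \<open>B\<close>; the interpretations named \<open>sw\<close> use this.\<close>

lemma swap_cut: "max_cut V E x l u n b B A"
proof (unfold_locales)
  show "B \<union> A = V" "B \<inter> A = {}" using cut by auto
  fix W assume "W \<subseteq> V"
  have "prod.swap ` (E \<inter> A \<times> B) = E \<inter> B \<times> A" by (force intro: E_sym)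
  then have "card (E \<inter> B \<times> A) = card (E \<inter> A \<times> B)" using card_swap by metis
  with max[OF \<open>W \<subseteq> V\<close>] show "card (E \<inter> W \<times> (V - W)) \<le> card (E \<inter> B \<times> A)" by simp
qed

lemma finite_AB: "finite A" "finite B" and A_sub: "A \<subseteq> V" and B_sub: "B \<subseteq> V"
  and V_diff_A: "V - A = B"
  using cut finite_V by (auto intro: finite_subset)

lemma card_AB: "real (card A) + real (card B) = real n"
  using card_Un_disjoint[OF finite_AB cut(2)] cut(1) card_V by (metis of_nat_add)

lemma finite_rel: "R \<subseteq> V \<times> V \<Longrightarrow> finite R"
  using finite_V finite_subset by blast

lemma card_missing_arcs:
  "real (card (E \<inter> A \<times> B)) + real (card (A \<times> B - E)) = real (card A) * real (card B)"
proof -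
  have "card (A \<times> B) = card ((E \<inter> A \<times> B) \<union> (A \<times> B - E))" by (rule arg_cong[of _ _ card]) auto
  also have "\<dots> = card (E \<inter> A \<times> B) + card (A \<times> B - E)"
    using finite_AB by (intro card_Un_disjoint) (auto simp: finite_E)
  finally show ?thesis by (simp add: card_cartesian_product flip: of_nat_mult of_nat_add)
qed

lemma swap_missing: "card (B \<times> A - E) = card (A \<times> B - E)"
proof -
  have "prod.swap ` (A \<times> B - E) = B \<times> A - E" by (force intro: E_sym)
  then show ?thesis using card_swap by metis
qed

text \<open>The maximum cut has at least as many edges as the cut around the neighbourhood of
  \<open>u\<close>. Since \<open>|A| * |B| = n^2 / 4 - (|A| - n / 2)^2\<close>, the missing pairs
  and the imbalance share one linear error.\<close>

lemma few_missing: "real (card (A \<times> B - E)) + (real (card A) - real n / 2)^2 \<le> 2 * real n + 3"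
proof -
  have "l^2 - 2 * real n - 2 \<le> real (card (E \<inter> A \<times> B))"
    using large_neighbourhood_cut max[OF nb_sub[of u]] by linarith
  moreover have "real (card A) * real (card B) = real n ^ 2 / 4 - (real (card A) - real n / 2)^2"
  proof -
    have B: "real (card B) = real n - real (card A)" using card_AB by simp
    show ?thesis unfolding B by (simp add: power2_eq_square algebra_simps)
  qed
  ultimately show ?thesis using card_missing_arcs l_sq_ge by linarith
qed

lemma card_missing_le: "real (card (A \<times> B - E)) \<le> 2 * real n + 3"
  using few_missing zero_le_power2[of "real (card A) - real n / 2"] by linarith

lemma card_A: "12 * real n \<le> 25 * real (card A)" "25 * real (card A) \<le> 13 * real n"
proof -
  \<comment> \<open>As \<open>5432 > 2 * 2500\<close>, the error \<open>2 * n + 3\<close> is below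
    \<open>(n / 50)^2\<close>; hence the bounds \<open>0.48 * n\<close> and
    \<open>0.52 * n\<close>.\<close>
  have "(real (card A) - real n / 2)^2 \<le> (real n / 50)^2"
  proof -
    have "5432 * real n \<le> real n * real n" using n_large by (intro mult_right_mono) auto
    moreover have "(real n / 50)^2 = real n * real n / 2500" by (simp add: power2_eq_square)
    ultimately show ?thesis using few_missing n_large by linarith
  qed
  then have "\<bar>real (card A) - real n / 2\<bar> \<le> real n / 50"
    using abs_le_square_iff[of "real (card A) - real n / 2" "real n / 50"] by simp
  then show "12 * real n \<le> 25 * real (card A)" "25 * real (card A) \<le> 13 * real n" by linarith+
qed

text \<open>The estimate for the neighbourhood cut is read as an upper bound for \<open>l\<close>,
  since no cut has more than \<open>n^2 / 4\<close> edges.\<close>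

lemma l_le: "l \<le> real n / 2 + 2"
proof (rule ccontr)
  assume "\<not> ?thesis"
  then have "(real n / 2 + 2)^2 \<le> l^2" using l_pos by (intro power_mono) auto
  moreover have "l^2 \<le> real (card A) * real (card B) + 2 * real n + 2"
    using large_neighbourhood_cut max[OF nb_sub[of u]] card_missing_arcs by linarith
  moreover have "real (card A) * real (card B) \<le> real n ^ 2 / 4"
  proof -
    have "4 * (real (card A) * real (card B)) = real n ^ 2 - (real (card A) - real (card B))^2"
      unfolding card_AB[symmetric] by (simp add: power2_eq_square algebra_simps)
    then show ?thesis using zero_le_power2[of "real (card A) - real (card B)"] by linarith
  qed
  ultimately show False by (simp add: power2_eq_square algebra_simps)
qed

text \<open>Moving \<open>v\<close> to the other side does not enlarge a maximum cut.\<close>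

lemma inner_le_outer:
  assumes "v \<in> A"
  shows "card (E `` {v} \<inter> A) \<le> card (E `` {v} \<inter> B)"
proof -
  let ?X = "E \<inter> (A - {v}) \<times> B" and ?Y = "{v} \<times> (E `` {v} \<inter> B)" and ?Z = "(E `` {v} \<inter> A) \<times> {v}"
  have fN: "finite (E `` {v})" using finite_E by (simp add: finite_Image)
  have "V - (A - {v}) = insert v B" using assms A_sub V_diff_A by blast
  moreover have "\<And>w. (w, v) \<in> E \<longleftrightarrow> (v, w) \<in> E" using E_sym by blast
  ultimately have "E \<inter> (A - {v}) \<times> (V - (A - {v})) = ?X \<union> ?Z"
    using E_irrefl by auto
  moreover have "card (?X \<union> ?Z) = card ?X + card ?Z"
    using assms cut fN finite_E by (intro card_Un_disjoint) auto
  moreover have "E \<inter> A \<times> B = ?X \<union> ?Y" using assms cut by auto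
  moreover have "card (?X \<union> ?Y) = card ?X + card ?Y"
    using assms cut fN finite_E by (intro card_Un_disjoint) auto
  moreover have "card (E \<inter> (A - {v}) \<times> (V - (A - {v}))) \<le> card (E \<inter> A \<times> B)"
    using A_sub by (intro max) auto
  ultimately have "card ?Z \<le> card ?Y" by (metis add_le_cancel_left)
  then show ?thesis by (simp add: card_cartesian_product card_cartesian_product_singleton)
qed

text \<open>Arcs between the neighbours of \<open>v\<close> in \<open>A\<close> and those in \<open>B\<close> are triangular, so they are few.\<close>

lemma inner_degree:
  assumes "v \<in> A"
  shows "40 * real (card (E `` {v} \<inter> A)) \<le> real n"
proof -
  let ?P = "E `` {v} \<inter> A" and ?Q = "E `` {v} \<inter> B"
  have f: "finite ?P" "finite ?Q" using finite_AB by auto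
  have "card (?P \<times> ?Q) \<le> card (E \<inter> ?P \<times> ?Q \<union> (A \<times> B - E))"
    using finite_AB finite_E by (intro card_mono) auto
  also have "\<dots> \<le> card (E \<inter> ?P \<times> ?Q) + card (A \<times> B - E)" by (rule card_Un_le)
  finally have 1: "real (card ?P) * real (card ?Q)
      \<le> real (card (E \<inter> ?P \<times> ?Q)) + real (card (A \<times> B - E))"
    by (simp add: card_cartesian_product flip: of_nat_mult of_nat_add)
  let ?O = "E \<inter> ?P \<times> ?Q"
  have "2 * card ?O = card ?O + card (prod.swap ` ?O)" by (simp add: card_swap)
  also have "\<dots> = card (?O \<union> prod.swap ` ?O)"
    using cut finite_E by (intro card_Un_disjoint[symmetric]) auto
  also have "\<dots> \<le> card tri"
    by (intro card_mono finite_tri)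
      (auto intro: triI[OF _ E_sym E_sym] tri_sym[OF triI[OF _ E_sym E_sym]])
  finally have "2 * real (card ?O) \<le> 2 * real n + 2" using card_tri by linarith
  moreover have "real (card ?P) * real (card ?P) \<le> real (card ?P) * real (card ?Q)"
    using inner_le_outer[OF assms] by (intro mult_left_mono) auto
  \<comment> \<open>At most \<open>n + 1\<close> of the pairs are triangular edges and at most
    \<open>2 * n + 3\<close> are missing. As \<open>5432 > 3 * 1600\<close>, the sum is below
    \<open>(n / 40)^2\<close>.\<close>
  ultimately have 2: "real (card ?P) ^ 2 \<le> 3 * real n + 4"
    using 1 card_missing_le by (simp add: power2_eq_square)
  show ?thesis
  proof (rule ccontr)
    assume "\<not> ?thesis"
    then have "(real n / 40)^2 \<le> real (card ?P)^2" by (intro power_mono) auto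
    moreover have "5432 * real n \<le> real n * real n" using n_large by (intro mult_right_mono) auto
    moreover have "(real n / 40)^2 = real n * real n / 1600" by (simp add: power2_eq_square)
    moreover have "5432 \<le> real n" using n_large by simp
    ultimately show False using 2 by linarith
  qed
qed

text \<open>Summing the eigenvalue equation over \<open>A\<close> counts each arc from
  \<open>A\<close> with the weight of its head. The main term is that of a complete bipartite graph;
  inner arcs add to it and missing cross arcs subtract.\<close>

lemma sum_eigen:
  "l * sum x A = real (card A) * sum x B
    + (\<Sum>p\<in>E \<inter> A \<times> A. x (snd p)) - (\<Sum>p\<in>A \<times> B - E. x (snd p))"
proof -
  have "l * sum x A = (\<Sum>v\<in>A. \<Sum>w\<in>E `` {v}. x w)"
    unfolding sum_distrib_left using A_sub by (intro sum.cong refl eigen) auto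
  also have "\<dots> = (\<Sum>p\<in>E \<inter> A \<times> UNIV. x (snd p))" by (rule sum_Image[OF finite_E finite_AB(1)])
  also have "E \<inter> A \<times> UNIV = E \<inter> A \<times> A \<union> E \<inter> A \<times> B" using E_sub cut by auto
  also have "(\<Sum>p\<in>\<dots>. x (snd p)) = (\<Sum>p\<in>E \<inter> A \<times> A. x (snd p)) + (\<Sum>p\<in>E \<inter> A \<times> B. x (snd p))"
    using cut finite_E by (intro sum.union_disjoint) auto
  finally have 1: "l * sum x A = \<dots>" .
  have "real (card A) * sum x B = (\<Sum>p\<in>A \<times> B. x (snd p))"
    by (simp add: sum.cartesian_product[of "\<lambda>_ w. x w", symmetric, unfolded case_prod_beta])
  also have "A \<times> B = E \<inter> A \<times> B \<union> (A \<times> B - E)" by auto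
  also have "(\<Sum>p\<in>\<dots>. x (snd p)) = (\<Sum>p\<in>E \<inter> A \<times> B. x (snd p)) + (\<Sum>p\<in>A \<times> B - E. x (snd p))"
    using finite_AB finite_E by (intro sum.union_disjoint) auto
  finally show ?thesis using 1 by linarith
qed

end

text \<open>
  With \<open>c, k, s, t\<close> the part sizes and the total weights of the parts, \<open>g, h\<close> the weights of the arcs
  inside the parts and \<open>i, j\<close> those of the missing cross arcs, this composes the eigenvalue
  equations summed over the two parts.
\<close>

lemma two_step_identity:
  fixes l :: real
  assumes "l * s = c * t + g - i" "l * t = k * s + h - j"
  shows "(l^2 - c * k) * s = c * (h - j) + l * (g - i)"
proof -
  have "l^2 * s = l * (l * s)" by (simp add: power2_eq_square)
  also have "\<dots> = c * (l * t) + l * (g - i)" by (simp add: assms(1) algebra_simps)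
  also have "\<dots> = c * (k * s + h - j) + l * (g - i)" by (simp add: assms(2))
  finally show ?thesis by (simp add: algebra_simps)
qed

section \<open>Vertices with many missing cross edges\<close>

text \<open>Here \<open>d\<close> counts the deficient vertices, \<open>i\<close> is the weight of
  the missing cross arcs and \<open>g\<close> that of the inner arcs. A deficient vertex costs about
  \<open>0.15 * 0.56 * n = 0.084 * n\<close> and allows a gain of only
  \<open>13 / 12 * n / 20 < 0.055 * n\<close>.\<close>

lemma deficiency_contradiction:
  fixes d n i g :: real
  assumes "1 \<le> d" "5432 \<le> n" "d * ((15 * n / 100 - 27) * (56 / 100)) \<le> i"
    "12 * i < 13 * g" "20 * g \<le> n * d + 500"
  shows False
proof -
  \<comment> \<open>Eliminating \<open>i\<close> and \<open>g\<close> leaves \<open>n * d\<close>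
    with coefficient \<open>12 * 0.084 - 13 / 20 = 0.358\<close> and \<open>d\<close> with
    \<open>- 12 * 15.12 = - 181.44\<close>.\<close>
  have "1 * (358 * n - 181440) \<le> d * (358 * n - 181440)"
    using assms by (intro mult_right_mono) auto
  then have 1: "358 * n - 181440 \<le> 358 * (n * d) - 181440 * d" by (simp add: algebra_simps)
  have "d * ((15 * n / 100 - 27) * (56 / 100)) = 84 / 1000 * (n * d) - 1512 / 100 * d"
    by (simp add: field_simps)
  then show False using 1 assms by linarith
qed

text \<open>The threshold \<open>0.15 * n\<close> is a compromise: other vertices keep weight at
  least \<open>0.56\<close>, and two adjacent ones on one side keep \<open>(0.48 - 0.30) * n\<close>
  common neighbours, while a deficient vertex loses more than it can gain.\<close>

definition deficient :: "('a \<times> 'a) set \<Rightarrow> nat \<Rightarrow> 'a set \<Rightarrow> 'a set \<Rightarrow> 'a set" where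
  "deficient E n A B = {v \<in> A. 15 * real n < 100 * real (card (B - E `` {v}))}"

definition inner_paired :: "('a \<times> 'a) set \<Rightarrow> nat \<Rightarrow> 'a set \<Rightarrow> 'a set \<Rightarrow> 'a set" where
  "inner_paired E n A B =
    {v \<in> A - deficient E n A B. \<exists>w \<in> A - deficient E n A B. (v, w) \<in> E}"

context max_cut
begin

lemma n_ge: "5432 \<le> real n"
  using n_large by simp

lemma card_B: "12 * real n \<le> 25 * real (card B)" "25 * real (card B) \<le> 13 * real n"
  using card_A card_AB by linarith+

lemma x_sum_le_card: "X \<subseteq> V \<Longrightarrow> sum x X \<le> real (card X)"
  using sum_bounded_above[of X x 1] x_le_1 by (auto simp: subset_iff)

lemma x_arcs_le_card:
  assumes "R \<subseteq> V \<times> V"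
  shows "(\<Sum>p\<in>R. x (snd p)) \<le> real (card R)"
  using sum_bounded_above[of R "\<lambda>p. x (snd p)" 1] x_le_1 assms by (auto simp: subset_iff)

lemma x_arcs_nonneg: "R \<subseteq> V \<times> V \<Longrightarrow> 0 \<le> (\<Sum>p\<in>R. x (snd p))"
  by (intro sum_nonneg x_nonneg) auto

lemma rel_sub: "E \<inter> A \<times> A \<subseteq> V \<times> V" "E \<inter> B \<times> B \<subseteq> V \<times> V"
  "A \<times> B - E \<subseteq> V \<times> V" "B \<times> A - E \<subseteq> V \<times> V"
  using A_sub B_sub by auto

text \<open>The neighbours of \<open>u\<close> weigh \<open>l\<close> in total and at most
  \<open>n / 40\<close> of them lie in \<open>A\<close>, so \<open>B\<close> is heavy. The
  eigenvalue equation summed over \<open>A\<close> passes this weight back to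
  \<open>A\<close>.\<close>

lemma sums_ge_aux:
  assumes "u \<in> A"
  shows "9 * real n \<le> 20 * sum x A" and "9 * real n \<le> 20 * sum x B"
proof -
  have "l = (\<Sum>w\<in>E `` {u}. x w)" using eigen[OF u_in] x_u by simp
  also have "E `` {u} = (E `` {u} \<inter> A) \<union> (E `` {u} \<inter> B)" using nb_sub cut by blast
  also have "sum x \<dots> = sum x (E `` {u} \<inter> A) + sum x (E `` {u} \<inter> B)"
    using finite_AB cut by (intro sum.union_disjoint) auto
  also have "sum x (E `` {u} \<inter> B) \<le> sum x B"
    using finite_AB B_sub x_nonneg by (intro sum_mono2) auto
  also have "sum x (E `` {u} \<inter> A) \<le> real (card (E `` {u} \<inter> A))"
    using A_sub by (intro x_sum_le_card) auto
  finally have be: "real n / 2 - 1 - real n / 40 \<le> sum x B"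
    using inner_degree[OF assms] l_ge by linarith
  then show "9 * real n \<le> 20 * sum x B" using n_ge by linarith
  show "9 * real n \<le> 20 * sum x A"
  proof (rule ccontr)
    assume "\<not> ?thesis"
    then have "l * sum x A \<le> (real n / 2 + 2) * (9 * real n / 20)"
      using l_le l_pos A_sub x_nonneg by (intro mult_mono sum_nonneg) auto
    moreover have "(12 * real n / 25) * (real n / 2 - 1 - real n / 40) \<le> real (card A) * sum x B"
      using be card_A n_large by (intro mult_mono) auto
    moreover have "(\<Sum>p\<in>A \<times> B - E. x (snd p)) \<le> 2 * real n + 3"
      using x_arcs_le_card[OF rel_sub(3)] card_missing_le by linarith
    moreover have "0 \<le> (\<Sum>p\<in>E \<inter> A \<times> A. x (snd p))" by (rule x_arcs_nonneg[OF rel_sub(1)])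
    ultimately have "(12 * real n / 25) * (real n / 2 - 1 - real n / 40) - (2 * real n + 3)
        \<le> (real n / 2 + 2) * (9 * real n / 20)"
      using sum_eigen by linarith
    \<comment> \<open>The leading coefficients are \<open>0.48 * 0.475 = 0.228\<close> and
      \<open>0.5 * 0.45 = 0.225\<close>; their difference is scaled by \<open>1000\<close>.\<close>
    then have "3 * (real n * real n) \<le> 3380 * real n + 3000" by (simp add: algebra_simps)
    moreover have "5432 * real n \<le> real n * real n" using n_large by (intro mult_right_mono) auto
    ultimately show False using n_ge by linarith
  qed
qed

lemma sums_ge: "9 * real n \<le> 20 * sum x A" "9 * real n \<le> 20 * sum x B"
proof -
  interpret sw: max_cut V E x l u n b B A by (rule swap_cut)
  show "9 * real n \<le> 20 * sum x A" "9 * real n \<le> 20 * sum x B"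
    using u_in cut sums_ge_aux sw.sums_ge_aux by blast+
qed

text \<open>With \<open>|B| = b + k\<close> the product changes by \<open>k * (e - k)\<close>, where
  \<open>e\<close> is the parity of \<open>n\<close>. No integer lies strictly between
  \<open>0\<close> and \<open>e\<close>, so the change is never positive.\<close>

lemma product_le: "real (card A) * real (card B) \<le> real ((n - b) * b)"
proof -
  define k where "k = int (card B) - int b"
  define e where "e = int n - 2 * int b"
  have e: "e = 0 \<or> e = 1" unfolding e_def b_def by presburger
  have "k * (e - k) \<le> 0"
  proof (cases "k \<le> 0")
    case True then show ?thesis using e by (intro mult_nonpos_nonneg) auto
  next
    case False then show ?thesis using e by (intro mult_nonneg_nonpos) auto
  qed
  moreover have kk: "int (card A) = int n - int b - k" "int (card B) = int b + k"
    using card_AB by (simp_all add: k_def)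
  have "int (card A) * int (card B) = (int n - int b) * int b + k * (e - k)"
    unfolding kk e_def by (simp add: algebra_simps)
  moreover have "int (n - b) = int n - int b" using b_def by (simp add: of_nat_diff)
  ultimately have "int (card A * card B) \<le> int ((n - b) * b)" by simp
  then show ?thesis by (simp flip: of_nat_mult)
qed

lemma two_step:
  "(l^2 - real (card A) * real (card B)) * sum x A
    = real (card A) * ((\<Sum>p\<in>E \<inter> B \<times> B. x (snd p)) - (\<Sum>p\<in>B \<times> A - E. x (snd p)))
      + l * ((\<Sum>p\<in>E \<inter> A \<times> A. x (snd p)) - (\<Sum>p\<in>A \<times> B - E. x (snd p)))"
proof -
  interpret sw: max_cut V E x l u n b B A by (rule swap_cut)
  show ?thesis by (rule two_step_identity[OF sum_eigen sw.sum_eigen])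
qed

text \<open>As \<open>l^2 > |A| * |B|\<close>, the right-hand side of \<open>two_step\<close> is
  positive. Its factors \<open>|A|\<close> and \<open>l\<close> both lie between
  \<open>12 * n / 25\<close> and \<open>13 * n / 25\<close>, hence the ratio of \<open>12\<close> to
  \<open>13\<close>.\<close>

lemma missing_lt_inner:
  "12 * ((\<Sum>p\<in>A \<times> B - E. x (snd p)) + (\<Sum>p\<in>B \<times> A - E. x (snd p)))
    < 13 * ((\<Sum>p\<in>E \<inter> A \<times> A. x (snd p)) + (\<Sum>p\<in>E \<inter> B \<times> B. x (snd p)))"
    (is "12 * (?i + ?j) < 13 * (?g + ?h)")
proof -
  have nn: "0 \<le> ?i" "0 \<le> ?j" "0 \<le> ?g" "0 \<le> ?h"
    by (intro x_arcs_nonneg rel_sub)+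
  have "0 < (l^2 - real (card A) * real (card B)) * sum x A"
    using product_le l_sq sums_ge n_large by (intro mult_pos_pos) linarith+
  then have 1: "real (card A) * ?j + l * ?i < real (card A) * ?h + l * ?g"
    unfolding two_step by (simp add: algebra_simps)
  have l: "12 * real n / 25 \<le> l" "l \<le> 13 * real n / 25"
    using l_ge l_le n_ge by linarith+
  have "(12 * real n / 25) * ?j \<le> real (card A) * ?j" "(12 * real n / 25) * ?i \<le> l * ?i"
    "real (card A) * ?h \<le> (13 * real n / 25) * ?h" "l * ?g \<le> (13 * real n / 25) * ?g"
    using nn card_A l by (intro mult_right_mono; linarith)+
  with 1 have "(12 * real n / 25) * ?j + (12 * real n / 25) * ?i
      < (13 * real n / 25) * ?h + (13 * real n / 25) * ?g" by linarith
  then have "real n / 25 * (12 * (?i + ?j)) < real n / 25 * (13 * (?g + ?h))"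
    by (simp add: algebra_simps)
  then show ?thesis by (rule mult_left_less_imp_less) simp
qed

text \<open>The side \<open>B\<close> weighs at least \<open>0.45 * n\<close> and \<open>v\<close>
  misses at most \<open>0.15 * n\<close> of it, so \<open>l * x v \<ge> 0.30 * n\<close>, whereas
  \<open>0.56 * l \<le> 0.28 * n + 1.12\<close>.\<close>

lemma x_ge_aux:
  assumes "v \<in> A - deficient E n A B"
  shows "56 \<le> 100 * x v"
proof (rule ccontr)
  assume "\<not> ?thesis"
  then have "l * x v \<le> (real n / 2 + 2) * (56 / 100)"
    using l_le l_pos assms A_sub x_nonneg by (intro mult_mono) auto
  then have "l * x v \<le> 28 / 100 * real n + 112 / 100" by (simp add: algebra_simps)
  moreover have "sum x B = sum x (E `` {v} \<inter> B) + sum x (B - E `` {v})"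
    using finite_AB by (subst sum.union_disjoint[symmetric]) (auto intro: sum.cong)
  moreover have "sum x (E `` {v} \<inter> B) \<le> sum x (E `` {v})"
    using nb_sub[of v] x_nonneg finite_subset[OF nb_sub finite_V] by (intro sum_mono2) auto
  moreover have "sum x (B - E `` {v}) \<le> real (card (B - E `` {v}))"
    using B_sub by (intro x_sum_le_card) auto
  moreover have "100 * real (card (B - E `` {v})) \<le> 15 * real n"
    using assms by (auto simp: deficient_def)
  moreover have "l * x v = sum x (E `` {v})" using assms A_sub by (intro eigen) auto
  ultimately show False using sums_ge n_ge by linarith
qed

lemma missing_Image: "v \<in> A \<Longrightarrow> (A \<times> B - E) `` {v} = B - E `` {v}"
  by auto

lemma card_deficient_aux:
  "15 * real n * real (card (deficient E n A B)) \<le> 200 * real n + 300"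
proof -
  let ?D = "deficient E n A B" and ?M = "A \<times> B - E"
  have D: "?D \<subseteq> A" "finite ?D" using finite_AB by (auto simp: deficient_def)
  have "15 * real n * real (card ?D) = (\<Sum>v\<in>?D. 15 * real n)" by simp
  also have "\<dots> \<le> (\<Sum>v\<in>?D. 100 * real (card (?M `` {v})))"
    by (intro sum_mono) (auto simp: deficient_def missing_Image)
  also have "\<dots> = 100 * real (card (?M \<inter> ?D \<times> UNIV))"
    using finite_AB by (subst card_Image) (auto simp: D sum_distrib_left)
  also have "\<dots> \<le> 100 * real (card ?M)" using finite_AB by (simp add: card_mono)
  finally show ?thesis using card_missing_le by linarith
qed

text \<open>A deficient vertex lies in more than \<open>0.15 * n\<close> of the at most
  \<open>2 * n + 3\<close> missing pairs; the pairs are counted once from each side.\<close>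

lemma card_deficient: "card (deficient E n A B) + card (deficient E n B A) \<le> 27"
proof (rule ccontr)
  interpret sw: max_cut V E x l u n b B A by (rule swap_cut)
  assume "\<not> ?thesis"
  then have "28 \<le> real (card (deficient E n A B)) + real (card (deficient E n B A))" by linarith
  then have "real n * 28 \<le> real n * (real (card (deficient E n A B)) + real (card (deficient E n B A)))"
    by (intro mult_left_mono) auto
  then show False using card_deficient_aux sw.card_deficient_aux n_ge
    by (simp add: algebra_simps)
qed

text \<open>The common neighbours in \<open>B\<close> of an edge inside \<open>A\<close> give triangular arcs.\<close>

lemma card_tri_Image:
  assumes "v \<in> A" "w \<in> A" "(v, w) \<in> E"
  shows "real (card B) - real (card (B - E `` {v})) - real (card (B - E `` {w}))
    \<le> real (card (tri `` {v}))"
proof -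
  have "B \<subseteq> tri `` {v} \<union> (B - E `` {v}) \<union> (B - E `` {w})"
    using assms E_sym by (auto intro: triI)
  then have "card B \<le> card (tri `` {v} \<union> (B - E `` {v}) \<union> (B - E `` {w}))"
    using finite_AB finite_tri by (intro card_mono) (auto simp: finite_Image)
  also have "\<dots> \<le> card (tri `` {v}) + card (B - E `` {v}) + card (B - E `` {w})"
    by (meson add_right_mono card_Un_le order_trans)
  finally show ?thesis by linarith
qed

lemma inner_paired_tri:
  assumes "v \<in> inner_paired E n A B"
  shows "18 * real n / 100 \<le> real (card (tri `` {v}))"
proof -
  obtain w where w: "v \<in> A" "w \<in> A" "(v, w) \<in> E" "v \<notin> deficient E n A B" "w \<notin> deficient E n A B"
    using assms by (auto simp: inner_paired_def)
  then have "100 * real (card (B - E `` {v})) \<le> 15 * real n"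
    "100 * real (card (B - E `` {w})) \<le> 15 * real n"
    by (auto simp: deficient_def)
  then show ?thesis using card_tri_Image[OF w(1-3)] card_B by linarith
qed

text \<open>Two rounds: the degree sum excludes \<open>12\<close> vertices, as
  \<open>12 * 0.18 * n > 2 * n + 2\<close>. In so small a set few triangular arcs stay inside, so
  the others count twice and the bound halves.\<close>

lemma card_inner_paired: "card (inner_paired E n A B \<union> inner_paired E n B A) \<le> 5"
proof -
  interpret sw: max_cut V E x l u n b B A by (rule swap_cut)
  let ?X = "inner_paired E n A B \<union> inner_paired E n B A"
  let ?s = "real (card ?X)"
  have X: "?X \<subseteq> V" "\<And>v. v \<in> ?X \<Longrightarrow> 18 * real n / 100 \<le> real (card (tri `` {v}))"
    using inner_paired_tri sw.inner_paired_tri A_sub B_sub unfolding inner_paired_def by blast+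
  have s11: "card ?X < 12"
  proof (rule ccontr)
    assume "\<not> ?thesis"
    then have "12 * (18 * real n / 100) \<le> ?s * (18 * real n / 100)"
      by (intro mult_right_mono) auto
    then show False using card_Image_ge(1)[OF X] card_tri n_ge by linarith
  qed
  show ?thesis
  proof (rule ccontr)
    assume "\<not> ?thesis"
    then have "2 * 6 * (18 * real n / 100 - 11) \<le> 2 * ?s * (18 * real n / 100 - ?s)"
      using s11 n_large by (intro mult_mono) auto
    then have "216 / 100 * real n - 132 \<le> 2 * ?s * (18 * real n / 100 - ?s)" by simp
    then show False using card_Image_ge(2)[OF X] card_tri n_ge by linarith
  qed
qed

text \<open>An inner arc has a deficient end or joins two vertices of \<open>inner_paired\<close>. A
  deficient vertex has at most \<open>n / 40\<close> inner neighbours; the two directions make this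
  \<open>n / 20\<close>.\<close>

lemma card_inner_arcs:
  "20 * real (card (E \<inter> A \<times> A))
    \<le> real n * real (card (deficient E n A B)) + 20 * real (card (inner_paired E n A B))^2"
proof -
  let ?D = "deficient E n A B" and ?S = "inner_paired E n A B"
  let ?O = "(E \<inter> A \<times> A) \<inter> ?D \<times> UNIV"
  have D: "?D \<subseteq> A" "finite ?D" using finite_AB by (auto simp: deficient_def)
  have S: "finite ?S" using finite_AB by (auto simp: inner_paired_def)
  have "E \<inter> A \<times> A \<subseteq> ?O \<union> prod.swap ` ?O \<union> ?S \<times> ?S"
  proof
    fix p assume p: "p \<in> E \<inter> A \<times> A"
    then obtain v w where vw: "p = (v, w)" "(v, w) \<in> E" "(w, v) \<in> E" "v \<in> A" "w \<in> A"
      using E_sym by auto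
    have "(v, w) = prod.swap (w, v)" by simp
    then show "p \<in> ?O \<union> prod.swap ` ?O \<union> ?S \<times> ?S"
      using vw unfolding inner_paired_def by blast
  qed
  then have "card (E \<inter> A \<times> A) \<le> card (?O \<union> prod.swap ` ?O \<union> ?S \<times> ?S)"
    using S finite_E by (intro card_mono) auto
  also have "\<dots> \<le> card ?O + card (prod.swap ` ?O) + card (?S \<times> ?S)"
    by (meson add_right_mono card_Un_le order_trans)
  finally have "real (card (E \<inter> A \<times> A)) \<le> 2 * real (card ?O) + real (card ?S)^2"
    unfolding card_swap card_cartesian_product
    by (simp add: power2_eq_square flip: of_nat_mult of_nat_add)
  moreover have "40 * real (card ?O) \<le> real n * real (card ?D)"
  proof -
    have "40 * real (card ?O) = (\<Sum>v\<in>?D. 40 * real (card ((E \<inter> A \<times> A) `` {v})))"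
      using finite_E D by (subst card_Image) (auto simp: sum_distrib_left)
    also have "\<dots> = (\<Sum>v\<in>?D. 40 * real (card (E `` {v} \<inter> A)))"
      using D by (intro sum.cong refl arg_cong[of _ _ "\<lambda>k. 40 * real (card k)"]) auto
    also have "\<dots> \<le> (\<Sum>v\<in>?D. real n)" using D by (intro sum_mono inner_degree) auto
    finally show ?thesis by (simp add: mult.commute)
  qed
  ultimately show ?thesis by linarith
qed

text \<open>Of the more than \<open>0.15 * n\<close> non-neighbours of a deficient vertex across the
  cut, at most \<open>27\<close> are deficient; the others weigh at least \<open>0.56\<close>
  each.\<close>

lemma missing_ge_deficient:
  "real (card (deficient E n A B)) * ((15 * real n / 100 - 27) * (56 / 100))
    \<le> (\<Sum>p\<in>A \<times> B - E. x (snd p))"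
proof -
  interpret sw: max_cut V E x l u n b B A by (rule swap_cut)
  let ?D = "deficient E n A B" and ?M = "A \<times> B - E" and ?D' = "deficient E n B A"
  have D: "?D \<subseteq> A" "finite ?D" "finite ?D'" using finite_AB by (auto simp: deficient_def)
  have "(15 * real n / 100 - 27) * (56 / 100) \<le> sum x (?M `` {v})" if v: "v \<in> ?D" for v
  proof -
    have "card (?M `` {v}) \<le> card ((?M `` {v} - ?D') \<union> ?D')"
      using finite_AB D by (intro card_mono) (auto intro: finite_subset[of _ B])
    also have "\<dots> \<le> card (?M `` {v} - ?D') + card ?D'" by (rule card_Un_le)
    finally have "15 * real n / 100 - 27 \<le> real (card (?M `` {v} - ?D'))"
      using v card_deficient D by (auto simp: deficient_def missing_Image)
    then have "(15 * real n / 100 - 27) * (56 / 100) \<le> real (card (?M `` {v} - ?D')) * (56 / 100)"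
      by (intro mult_right_mono) auto
    also have "\<dots> \<le> sum x (?M `` {v} - ?D')"
      using sw.x_ge_aux by (intro sum_bounded_below) fastforce
    also have "\<dots> \<le> sum x (?M `` {v})"
      using finite_AB B_sub x_nonneg by (intro sum_mono2) (auto intro: finite_subset[of _ B])
    finally show ?thesis .
  qed
  then have "(\<Sum>v\<in>?D. (15 * real n / 100 - 27) * (56 / 100)) \<le> (\<Sum>v\<in>?D. sum x (?M `` {v}))"
    by (intro sum_mono)
  also have "\<dots> = (\<Sum>p\<in>?M \<inter> ?D \<times> UNIV. x (snd p))"
    using finite_AB D by (intro sum_Image) auto
  also have "\<dots> \<le> (\<Sum>p\<in>?M. x (snd p))"
    using finite_AB B_sub x_nonneg by (intro sum_mono2) auto
  finally show ?thesis by simp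
qed

lemma inner_sum_le:
  "20 * ((\<Sum>p\<in>E \<inter> A \<times> A. x (snd p)) + (\<Sum>p\<in>E \<inter> B \<times> B. x (snd p)))
    \<le> real n * (real (card (deficient E n A B)) + real (card (deficient E n B A))) + 500"
proof -
  interpret sw: max_cut V E x l u n b B A by (rule swap_cut)
  let ?S = "inner_paired E n A B" and ?S' = "inner_paired E n B A"
  have "card ?S + card ?S' = card (?S \<union> ?S')"
    using finite_AB cut by (intro card_Un_disjoint[symmetric]) (auto simp: inner_paired_def)
  \<comment> \<open>Both sides share the bound \<open>5\<close>, so the squares add up to at most
    \<open>25\<close>; hence \<open>500 = 20 * 25\<close>.\<close>
  then have "(real (card ?S) + real (card ?S'))^2 \<le> 5^2"
    using card_inner_paired by (intro power_mono) auto
  moreover have "real (card ?S)^2 + real (card ?S')^2 \<le> (real (card ?S) + real (card ?S'))^2"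
    by (simp add: power2_sum)
  moreover note x_arcs_le_card[OF rel_sub(1)] x_arcs_le_card[OF rel_sub(2)]
    card_inner_arcs sw.card_inner_arcs
  ultimately show ?thesis by (simp add: distrib_left)
qed

lemma no_deficient: "deficient E n A B = {}" "deficient E n B A = {}"
proof -
  interpret sw: max_cut V E x l u n b B A by (rule swap_cut)
  let ?d = "real (card (deficient E n A B)) + real (card (deficient E n B A))"
  have f: "finite (deficient E n A B)" "finite (deficient E n B A)"
    using finite_AB by (auto simp: deficient_def)
  have "?d = 0"
  proof (rule ccontr)
    assume "?d \<noteq> 0"
    then have "card (deficient E n A B) + card (deficient E n B A) \<noteq> 0" by (metis add_0 of_nat_0 of_nat_add)
    then have "1 \<le> ?d" by linarith
    moreover have "?d * ((15 * real n / 100 - 27) * (56 / 100))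
        \<le> (\<Sum>p\<in>A \<times> B - E. x (snd p)) + (\<Sum>p\<in>B \<times> A - E. x (snd p))"
      using missing_ge_deficient sw.missing_ge_deficient by (simp only: distrib_right)
    ultimately show False
      using deficiency_contradiction[OF _ n_ge _ missing_lt_inner inner_sum_le] by blast
  qed
  then have "card (deficient E n A B) = 0" "card (deficient E n B A) = 0" by linarith+
  then show "deficient E n A B = {}" "deficient E n B A = {}" using f by auto
qed

section \<open>From few inner edges to at most one\<close>

lemma x_ge: "v \<in> V \<Longrightarrow> 56 / 100 \<le> x v"
proof -
  interpret sw: max_cut V E x l u n b B A by (rule swap_cut)
  assume "v \<in> V"
  then show ?thesis using x_ge_aux[of v] sw.x_ge_aux[of v] no_deficient cut by force
qed

text \<open>Without deficient vertices the inner arcs weigh at most \<open>25\<close>. Each missing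
  pair weighs at least \<open>2 * 0.56\<close> over its two arcs, and
  \<open>13 * 25 / (12 * 1.12) < 25\<close>.\<close>

lemma card_missing: "card (A \<times> B - E) \<le> 24"
proof -
  have "real (card R) * (56 / 100) \<le> (\<Sum>p\<in>R. x (snd p))" if "R \<subseteq> V \<times> V" for R
    using that x_ge by (intro sum_bounded_below) auto
  from this[OF rel_sub(3)] this[OF rel_sub(4)] show ?thesis
    using missing_lt_inner inner_sum_le by (simp add: no_deficient swap_missing)
qed

lemma card_nonneighbours: "v \<in> A \<Longrightarrow> card (B - E `` {v}) \<le> 24"
proof -
  assume v: "v \<in> A"
  have "card (B - E `` {v}) = card ({v} \<times> (B - E `` {v}))"
    by (simp add: card_cartesian_product_singleton)
  also have "\<dots> \<le> card (A \<times> B - E)" using v finite_AB by (intro card_mono) auto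
  finally show ?thesis using card_missing by linarith
qed

lemma inner_tri:
  assumes "v \<in> A" "w \<in> A" "(v, w) \<in> E"
  shows "real (card B) - 48 \<le> real (card (tri `` {v}))"
  using card_tri_Image[OF assms] card_nonneighbours[OF assms(1)] card_nonneighbours[OF assms(2)]
  by linarith

text \<open>Each end of an inner edge now misses at most \<open>24\<close> vertices across the cut.
  Three to five such ends would give at least \<open>2.88 * n - 318\<close> triangular arcs, more
  than \<open>2 * n + 2\<close>.\<close>

lemma card_inner_vertices:
  "card (inner_paired E n A B \<union> inner_paired E n B A) \<le> 2"
proof (rule ccontr)
  interpret sw: max_cut V E x l u n b B A by (rule swap_cut)
  let ?X = "inner_paired E n A B \<union> inner_paired E n B A" and ?D = "12 * real n / 25 - 48"
  assume "\<not> ?thesis"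
  then have "2 * 3 * (?D - 5) \<le> 2 * real (card ?X) * (?D - real (card ?X))"
    using card_inner_paired n_large by (intro mult_mono) auto
  then have "288 / 100 * real n - 318 \<le> 2 * real (card ?X) * (?D - real (card ?X))" by simp
  moreover have "2 * real (card ?X) * (?D - real (card ?X)) \<le> real (card tri)"
  proof (rule card_Image_ge(2))
    show "?X \<subseteq> V" using A_sub B_sub by (auto simp: inner_paired_def)
    show "?D \<le> real (card (tri `` {v}))" if "v \<in> ?X" for v
      using that inner_tri[of v] sw.inner_tri[of v] card_A card_B
      by (fastforce simp: inner_paired_def)
  qed
  ultimately show False using card_tri n_ge by linarith
qed

end

section \<open>Exact structure with one inner edge\<close>

text \<open>Here \<delta> is \<open>l^2 - |A| * |B|\<close>, \<open>c\<close> is \<open>|A|\<close>,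
  \<open>s\<close> the weight of \<open>A\<close>, \<open>g\<close> that of the inner arcs, and
  \<open>i\<close>, \<open>j\<close> those of the missing arcs in each direction. One inner edge
  minus one missing edge allows \<open>\<delta> * s\<close> to be only about
  \<open>0.45 * n\<close>, but \<delta> is nearly \<open>2\<close> or larger, which forces about
  \<open>0.9 * n\<close>.\<close>

lemma one_edge_contradiction:
  fixes l n b \<delta> c s i j :: real
  assumes "2 * b \<le> \<delta> * (l - 1)" "n - 1 \<le> 2 * b" "5432 \<le> n" "1 < l" "l \<le> n / 2 + 2"
    "9 * n \<le> 20 * s" "12 * n \<le> 25 * c" "56 / 100 \<le> i" "56 / 100 \<le> j" "g \<le> 2"
    "\<delta> * s = l * (g - i) - c * j"
  shows False
proof -
  have "\<delta> * s \<le> 144 / 100 * (n / 2 + 2) - (12 * n / 25) * (56 / 100)"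
  proof -
    have "l * (g - i) \<le> l * (144 / 100)" using assms by (intro mult_left_mono) auto
    moreover have "(12 * n / 25) * (56 / 100) \<le> c * j" using assms by (intro mult_mono) auto
    ultimately show ?thesis using assms by (simp add: algebra_simps)
  qed
  then have 1: "\<delta> * s \<le> 452 / 1000 * n + 288 / 100" using assms(3) by (simp add: algebra_simps)
  have "0 < 2 * b" using assms by linarith
  then have d: "0 < \<delta>" using assms by (smt (verit) mult_nonpos_nonneg)
  have "(n - 1) * (9 * n / 20) \<le> (2 * b) * s" using assms by (intro mult_mono) auto
  also have "\<dots> \<le> (\<delta> * (l - 1)) * s" using assms by (intro mult_right_mono) auto
  also have "\<dots> = (\<delta> * s) * (l - 1)" by simp
  also have "\<dots> \<le> (452 / 1000 * n + 288 / 100) * (n / 2 + 1)"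
    using 1 assms d by (intro mult_mono) auto
  finally have "224 * (n * n) \<le> 2342 * n + 2880" by (simp add: field_simps)
  moreover have "5432 * n \<le> n * n" using assms by (intro mult_right_mono) auto
  ultimately show False using assms(3) by linarith
qed

context max_cut
begin

lemma n_le_2b: "real n - 1 \<le> 2 * real b"
  using b_def by linarith

lemma l_gt_1: "1 < l"
  using l_ge n_ge by linarith

lemma surplus_ge: "2 * real b \<le> (l^2 - real (card A) * real (card B)) * (l - 1)"
proof -
  have "(l^2 - real ((n - b) * b)) * (l - 1) \<le> (l^2 - real (card A) * real (card B)) * (l - 1)"
    using product_le l_gt_1 by (intro mult_right_mono) auto
  then show ?thesis using l_plus by linarith
qed

lemma single_inner_edge_complete:
  assumes EA: "E \<inter> A \<times> A = {(p, q), (q, p)}" and EB: "E \<inter> B \<times> B = {}"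
  shows "A \<times> B \<subseteq> E"
proof (rule ccontr)
  assume "\<not> ?thesis"
  then obtain v w where vw: "v \<in> A" "w \<in> B" "(v, w) \<in> A \<times> B - E" by auto
  then have wv: "(w, v) \<in> B \<times> A - E" using E_sym by blast
  have pq: "(p, q) \<in> E" "p \<in> A" "q \<in> A" using EA by auto
  then have "p \<noteq> q" using E_irrefl by auto
  then have "(\<Sum>z\<in>E \<inter> A \<times> A. x (snd z)) \<le> 2"
    unfolding EA using pq A_sub x_le_1[of p] x_le_1[of q] by (auto simp: subset_iff)
  moreover have "(\<Sum>z\<in>R. x (snd z)) \<ge> 56 / 100" if "R \<subseteq> V \<times> V" "z \<in> R" for R z
  proof -
    have "56 / 100 \<le> x (snd z)" using that by (intro x_ge) auto
    also have "\<dots> \<le> (\<Sum>z\<in>R. x (snd z))"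
      using that x_nonneg finite_rel by (intro member_le_sum) auto
    finally show ?thesis .
  qed
  note this[OF rel_sub(3) vw(3)] this[OF rel_sub(4) wv]
  ultimately show False
    using two_step unfolding EB
    by (intro one_edge_contradiction[OF surplus_ge n_le_2b n_ge l_gt_1 l_le sums_ge(1) card_A(1)])
      auto
qed

text \<open>The eigenvalue equations at \<open>p\<close> and \<open>q\<close>, with the sums over
  the sides, give \<open>(l^2 - |A| * |B|) * (l - 1) = 2 * |B|\<close>, so
  \<open>|B| \<ge> b\<close> by \<open>surplus_ge\<close>. At least \<open>2 * |B| + 1\<close> edges
  are triangular, so \<open>|B| \<le> b\<close>.\<close>

lemma single_inner_edge_card:
  assumes EA: "E \<inter> A \<times> A = {(p, q), (q, p)}" and EB: "E \<inter> B \<times> B = {}"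
  shows "card B = b"
proof -
  interpret sw: max_cut V E x l u n b B A by (rule swap_cut)
  note AB = single_inner_edge_complete[OF assms]
  then have BA: "B \<times> A \<subseteq> E" using E_sym by blast
  have pq: "(p, q) \<in> E" "(q, p) \<in> E" "p \<in> A" "q \<in> A" using EA by auto
  then have "p \<noteq> q" using E_irrefl by auto
  let ?s = "sum x A" and ?t = "sum x B" and ?c = "real (card A)" and ?k = "real (card B)"
  have "w = q" if "(p, w) \<in> E" "w \<in> A" for w
  proof -
    have "(p, w) \<in> E \<inter> A \<times> A" using that pq by simp
    then show ?thesis unfolding EA using \<open>p \<noteq> q\<close> by simp
  qed
  moreover have "w = p" if "(q, w) \<in> E" "w \<in> A" for w
  proof -
    have "(q, w) \<in> E \<inter> A \<times> A" using that pq by simp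
    then show ?thesis unfolding EA using \<open>p \<noteq> q\<close> by simp
  qed
  moreover have "w \<in> A \<or> w \<in> B" if "(v, w) \<in> E" for v w using that E_sub cut by blast
  moreover have "(v, w) \<in> E" if "v \<in> A" "w \<in> B" for v w using that AB by blast
  ultimately have nb: "E `` {p} = insert q B" "E `` {q} = insert p B"
    unfolding Image_singleton using pq by blast+
  have "q \<notin> B" "p \<notin> B" using pq cut by auto
  then have "l * x p = x q + ?t" "l * x q = x p + ?t"
    using eigen[of p] eigen[of q] pq A_sub finite_AB by (auto simp: nb)
  then have 1: "(l - 1) * (x p + x q) = 2 * ?t" by (simp add: algebra_simps)
  have e: "A \<times> B - E = {}" "B \<times> A - E = {}" using AB BA by auto
  have 2: "l * ?s = ?c * ?t + (x p + x q)"
    using sum_eigen \<open>p \<noteq> q\<close> unfolding EA e by simp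
  have 3: "l * ?t = ?k * ?s" using sw.sum_eigen unfolding EB e by simp
  have "(l^2 - ?c * ?k) * (l - 1) * ?s = (l - 1) * (l * (l * ?s)) - ?c * (?k * ?s) * (l - 1)"
    by (simp add: power2_eq_square algebra_simps)
  also have "\<dots> = l * ((l - 1) * (x p + x q))" unfolding 2 3[symmetric] by (simp add: algebra_simps)
  also have "\<dots> = 2 * ?k * ?s" unfolding 1 using 3 by simp
  finally have "(l^2 - ?c * ?k) * (l - 1) = 2 * ?k" using sums_ge(1) n_ge by auto
  then have "b \<le> card B" using surplus_ge by linarith
  moreover have "card B \<le> b"
  proof -
    have "0 < card B" using \<open>b \<le> card B\<close> n_large b_def by linarith
    then obtain z where z: "z \<in> B" by (metis card.empty equals0I less_irrefl)
    let ?P = "{p, q} \<times> B" and ?Q = "B \<times> {p, q}" and ?R = "{(p, q), (q, p)}"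
    have "(p, q) \<in> tri" using pq z BA AB by (intro triI[of p q z]) blast+
    moreover have "(p, w) \<in> tri" "(q, w) \<in> tri" if "w \<in> B" for w
      using pq that BA AB by (intro triI[of p w q] triI[of q w p]; blast)+
    ultimately have "?P \<union> ?Q \<union> ?R \<subseteq> tri" using tri_sym by blast
    then have "card (?P \<union> ?Q \<union> ?R) \<le> card tri" by (intro card_mono finite_tri)
    moreover have "card tri \<le> 4 * b + 2" unfolding tri_def by (rule few_triangular)
    moreover have "card (?P \<union> ?Q \<union> ?R) = card (?P \<union> ?Q) + card ?R"
      using \<open>p \<notin> B\<close> \<open>q \<notin> B\<close> finite_AB by (intro card_Un_disjoint) auto
    moreover have "card (?P \<union> ?Q) = card ?P + card ?Q"
      using \<open>p \<notin> B\<close> \<open>q \<notin> B\<close> finite_AB by (intro card_Un_disjoint) auto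
    moreover have "card ?P = 2 * card B" "card ?Q = 2 * card B" "card ?R = 2"
      using \<open>p \<noteq> q\<close> by (simp_all add: card_cartesian_product)
    ultimately show ?thesis by linarith
  qed
  ultimately show ?thesis by simp
qed

lemma arcs_split: "E = E \<inter> A \<times> A \<union> E \<inter> B \<times> B \<union> E \<inter> A \<times> B \<union> E \<inter> B \<times> A"
  using E_sub cut by blast

text \<open>The ends of inner arcs form a set of at most two vertices, so it is
  \<open>{p, q}\<close>; as both lie in \<open>A\<close>, no inner arc lies in
  \<open>B\<close>.\<close>

lemma plus_partition_aux:
  assumes "(p, q) \<in> E" "p \<in> A" "q \<in> A"
  shows "p \<noteq> q \<and> card B = b \<and> E = A \<times> B \<union> B \<times> A \<union> {(p, q), (q, p)}"
proof -
  let ?S = "inner_paired E n A B \<union> inner_paired E n B A"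
  have fS: "finite ?S" using finite_AB by (auto simp: inner_paired_def)
  have ne: "p \<noteq> q" using assms E_irrefl by auto
  have inner: "v \<in> ?S" if "(v, w) \<in> E" "v \<in> A" "w \<in> A" for v w
    using that no_deficient by (auto simp: inner_paired_def)
  then have "{p, q} \<subseteq> ?S" using assms E_sym by blast
  then have S: "?S = {p, q}"
    using card_inner_vertices card_seteq[OF fS] ne by (metis card_2_iff)
  have EA: "E \<inter> A \<times> A = {(p, q), (q, p)}"
  proof
    show "E \<inter> A \<times> A \<subseteq> {(p, q), (q, p)}"
    proof
      fix z assume "z \<in> E \<inter> A \<times> A"
      then obtain v w where vw: "z = (v, w)" "(v, w) \<in> E" "v \<in> A" "w \<in> A" by blast
      then have "v \<in> ?S" "w \<in> ?S" using E_sym inner by blast+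
      moreover have "v \<noteq> w" using vw E_irrefl by blast
      ultimately show "z \<in> {(p, q), (q, p)}" using vw(1) unfolding S by blast
    qed
  qed (use assms E_sym in blast)
  have EB: "E \<inter> B \<times> B = {}"
  proof (rule ccontr)
    assume "\<not> ?thesis"
    then obtain v w where vw: "(v, w) \<in> E" "v \<in> B" "w \<in> B" by auto
    then have "v \<in> ?S" using no_deficient by (auto simp: inner_paired_def)
    then show False using vw assms cut unfolding S by blast
  qed
  have "E \<inter> A \<times> B = A \<times> B" "E \<inter> B \<times> A = B \<times> A"
    using single_inner_edge_complete[OF EA EB] E_sym by blast+
  then show ?thesis using ne single_inner_edge_card[OF EA EB] arcs_split EA EB by auto
qed

lemma ex_inner_arc: "\<exists>p q. (p, q) \<in> E \<and> (p \<in> A \<and> q \<in> A \<or> p \<in> B \<and> q \<in> B)"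
proof (rule ccontr)
  assume "\<not> ?thesis"
  then have "E \<inter> A \<times> A = {}" "E \<inter> B \<times> B = {}" by blast+
  then show False
    using missing_lt_inner x_arcs_nonneg[OF rel_sub(3)] x_arcs_nonneg[OF rel_sub(4)] by simp
qed

end

context perron_graph
begin

lemma ex_max_cut: "\<exists>A. max_cut V E x l u n b A (V - A)"
proof -
  let ?f = "\<lambda>W. card (E \<inter> W \<times> (V - W))"
  have "Max (?f ` Pow V) \<in> ?f ` Pow V" using finite_V by (intro Max_in) auto
  then obtain A where A: "A \<subseteq> V" "Max (?f ` Pow V) = ?f A" by auto
  have "?f W \<le> ?f A" if "W \<subseteq> V" for W
    unfolding A(2)[symmetric] using that finite_V by (intro Max_ge) auto
  then show ?thesis using A by (intro exI[of _ A]) (unfold_locales, auto)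
qed

lemma ex_plus_partition:
  "\<exists>A B p q. A \<union> B = V \<and> A \<inter> B = {} \<and> p \<in> A \<and> q \<in> A \<and> p \<noteq> q \<and> card B = b \<and>
     E = A \<times> B \<union> B \<times> A \<union> {(p, q), (q, p)}"
proof -
  obtain A where "max_cut V E x l u n b A (V - A)" using ex_max_cut by blast
  then interpret max_cut V E x l u n b A "V - A" .
  interpret sw: max_cut V E x l u n b "V - A" A by (rule swap_cut)
  obtain p q where pq: "(p, q) \<in> E" "p \<in> A \<and> q \<in> A \<or> p \<in> V - A \<and> q \<in> V - A"
    using ex_inner_arc by blast
  then show ?thesis
    using plus_partition_aux[of p q] sw.plus_partition_aux[of p q] cut sw.cut by metis
qed

end

section \<open>Existence of the Perron vector\<close>

text \<open>For the adjacency matrix \<open>M\<close> this is \<open>y^T M y\<close>; each edge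
  contributes twice, once per arc.\<close>

definition quad_form :: "('a \<times> 'a) set \<Rightarrow> ('a \<Rightarrow> real) \<Rightarrow> real" where
  "quad_form E y = (\<Sum>p\<in>E. y (fst p) * y (snd p))"

lemma sum_arcs_from:
  fixes f :: "'b \<Rightarrow> real"
  assumes "finite E"
  shows "(\<Sum>p\<in>E. if fst p = v then f (snd p) else 0) = (\<Sum>w\<in>E `` {v}. f w)"
proof -
  have "(\<Sum>w\<in>E `` {v}. f w) = (\<Sum>p\<in>E \<inter> {v} \<times> UNIV. f (snd p))"
    using sum_Image[OF assms, of "{v}" f] by simp
  also have "\<dots> = (\<Sum>p\<in>E. if p \<in> {v} \<times> UNIV then f (snd p) else 0)"
    using assms by (rule sum.inter_restrict)
  also have "\<dots> = (\<Sum>p\<in>E. if fst p = v then f (snd p) else 0)"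
    by (intro sum.cong) (auto simp: mem_Times_iff)
  finally show ?thesis by simp
qed

lemma sum_arcs_to:
  fixes f :: "'a \<Rightarrow> real"
  assumes "finite E" and sym: "\<And>v w. (v, w) \<in> E \<Longrightarrow> (w, v) \<in> E"
  shows "(\<Sum>p\<in>E. if snd p = v then f (fst p) else 0) = (\<Sum>w\<in>E `` {v}. f w)"
proof -
  have "bij_betw prod.swap E E"
    by (rule bij_betwI[of _ _ _ prod.swap]) (auto intro: sym)
  from sum.reindex_bij_betw[OF this, of "\<lambda>p. if snd p = v then f (fst p) else 0"]
  show ?thesis using sum_arcs_from[OF assms(1), of v f] by (simp cong: if_cong)
qed

lemma quad_form_eigen:
  assumes "finite V" "E \<subseteq> V \<times> V" "\<And>v. v \<in> V \<Longrightarrow> (\<Sum>w\<in>E `` {v}. y w) = k * y v"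
  shows "quad_form E y = k * (\<Sum>v\<in>V. (y v)^2)"
proof -
  have "finite E" using assms finite_subset by blast
  have "k * (\<Sum>v\<in>V. (y v)^2) = (\<Sum>v\<in>V. k * (y v)^2)" by (rule sum_distrib_left)
  also have "\<dots> = (\<Sum>v\<in>V. y v * (\<Sum>w\<in>E `` {v}. y w))"
    by (intro sum.cong refl) (simp add: assms(3) power2_eq_square)
  also have "\<dots> = (\<Sum>v\<in>V. \<Sum>w\<in>E `` {v}. y v * y w)" by (simp add: sum_distrib_left)
  also have "\<dots> = (\<Sum>p\<in>Sigma V (\<lambda>v. E `` {v}). y (fst p) * y (snd p))"
    using assms(1) \<open>finite E\<close> by (subst sum.Sigma) (auto simp: case_prod_beta finite_Image)
  also have "Sigma V (\<lambda>v. E `` {v}) = E" using assms(2) by auto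
  finally show ?thesis by (simp add: quad_form_def)
qed

text \<open>The form attains a maximum on the compact set of nonnegative unit vectors. Passing from
  \<open>y\<close> to absolute values keeps the norm and does not decrease the form, so this maximum
  governs all vectors.\<close>

lemma ex_nonneg_maximizer:
  assumes V: "finite V" "V \<noteq> {}" and E: "E \<subseteq> V \<times> V"
  obtains x where "\<And>v. v \<in> V \<Longrightarrow> 0 \<le> x v" "(\<Sum>v\<in>V. (x v)^2) = 1"
    "\<And>y. quad_form E y \<le> quad_form E x * (\<Sum>v\<in>V. (y v)^2)"
proof -
  \<comment> \<open>Vectors are total functions; pinning them to \<open>0\<close> outside
    \<open>V\<close> makes the domain a product of compact sets.\<close>
  define S :: "'a \<Rightarrow> real set" where "S v = (if v \<in> V then {0..1} else {0})" for v
  define K where "K = PiE UNIV S \<inter> {y. (\<Sum>v\<in>V. (y v)^2) = 1}"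
  have cont: "continuous_on UNIV (\<lambda>y :: 'a \<Rightarrow> real. y v)" for v by simp
  have "compact (PiE UNIV S)"
    unfolding compactin_euclidean_iff[symmetric] euclidean_product_topology[symmetric]
    by (subst compactin_PiE) (auto simp: S_def)
  moreover have "closed {y :: 'a \<Rightarrow> real. (\<Sum>v\<in>V. (y v)^2) = 1}"
    by (intro closed_Collect_eq continuous_intros cont)
  ultimately have "compact K" unfolding K_def by (rule compact_Int_closed)
  moreover have "K \<noteq> {}"
  proof -
    obtain v where "v \<in> V" using V by blast
    have "(\<Sum>w\<in>V. (if w = v then 1 else 0 :: real)^2) = (\<Sum>w\<in>V. if w = v then 1 else 0)"
      by (intro sum.cong) auto
    also have "\<dots> = 1" using V \<open>v \<in> V\<close> by simp
    finally have "(\<lambda>w. if w = v then 1 else 0) \<in> K" using \<open>v \<in> V\<close> by (auto simp: K_def S_def)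
    then show ?thesis by blast
  qed
  moreover have "continuous_on K (quad_form E)"
    unfolding quad_form_def
    by (intro continuous_intros continuous_on_subset[OF cont]) auto
  ultimately obtain x where x: "x \<in> K" "\<And>y. y \<in> K \<Longrightarrow> quad_form E y \<le> quad_form E x"
    using continuous_attains_sup by metis
  show thesis
  proof
    show "0 \<le> x v" if "v \<in> V" for v
    proof -
      have "x v \<in> S v" using x(1) by (auto simp: K_def)
      then show ?thesis using that by (simp add: S_def)
    qed
    show "(\<Sum>v\<in>V. (x v)^2) = 1" using x(1) by (simp add: K_def)
    fix y :: "'a \<Rightarrow> real"
    let ?N = "\<Sum>v\<in>V. (y v)^2"
    have N0: "0 \<le> ?N" by (intro sum_nonneg) auto
    show "quad_form E y \<le> quad_form E x * ?N"
    proof (cases "?N = 0")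
      case True
      then have "\<forall>v\<in>V. y v = 0" using V by (simp add: sum_nonneg_eq_0_iff)
      then have "quad_form E y = 0" using E unfolding quad_form_def by (intro sum.neutral) auto
      then show ?thesis using True by simp
    next
      case False
      define z where "z v = (if v \<in> V then \<bar>y v\<bar> / sqrt ?N else 0)" for v
      have le: "(y v)^2 \<le> ?N" if "v \<in> V" for v
        using that V by (intro member_le_sum) auto
      have "\<bar>y v\<bar> \<le> sqrt ?N" if "v \<in> V" for v
        using real_sqrt_le_mono[OF le[OF that]] by simp
      then have "z \<in> PiE UNIV S"
        using False N0 by (auto simp: z_def S_def divide_le_eq_1)
      moreover have "(\<Sum>v\<in>V. (z v)^2) = (\<Sum>v\<in>V. (y v)^2 / ?N)"
        using N0 by (intro sum.cong) (auto simp: z_def power_divide)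
      then have "(\<Sum>v\<in>V. (z v)^2) = 1" using False by (simp add: sum_divide_distrib[symmetric])
      ultimately have "quad_form E z \<le> quad_form E x" using x(2) by (simp add: K_def)
      have "quad_form E y \<le> (\<Sum>p\<in>E. \<bar>y (fst p)\<bar> * \<bar>y (snd p)\<bar>)"
        unfolding quad_form_def by (intro sum_mono) (metis abs_ge_self abs_mult)
      also have "\<dots> = (\<Sum>p\<in>E. ?N * (z (fst p) * z (snd p)))"
        using E False N0 by (intro sum.cong) (auto simp: z_def)
      also have "\<dots> = quad_form E z * ?N" by (simp add: quad_form_def sum_distrib_left mult.commute)
      also have "\<dots> \<le> quad_form E x * ?N"
        using \<open>quad_form E z \<le> quad_form E x\<close> N0 by (intro mult_right_mono)
      finally show ?thesis .
    qed
  qed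
qed

text \<open>Near \<open>0\<close> a quadratic term cannot dominate a linear one:
  \<open>t = c / (q + 1)\<close> turns the inequality into
  \<open>(q + 2) * t^2 \<le> 0\<close>.\<close>

lemma first_order_condition:
  fixes c q :: real
  assumes "0 \<le> q" "\<And>t. 2 * t * c \<le> q * t^2"
  shows "c = 0"
proof (rule ccontr)
  assume "c \<noteq> 0"
  define t where "t = c / (q + 1)"
  have c: "c = t * (q + 1)" and "t \<noteq> 0"
    using \<open>c \<noteq> 0\<close> assms(1) by (auto simp: t_def)
  have "(q + 2) * t^2 \<le> 0"
    using assms(2)[of t] unfolding c by (simp add: power2_eq_square algebra_simps)
  moreover have "0 < (q + 2) * t^2" using assms(1) \<open>t \<noteq> 0\<close> by simp
  ultimately show False by simp
qed

text \<open>Changing the coordinate \<open>v\<close> by \<open>t\<close> changes the form by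
  \<open>2 * t\<close> times the neighbour sum, with no \<open>t^2\<close> term since there are no
  loops. Maximality then compares the linear terms.\<close>

lemma maximizer_eigen:
  assumes V: "finite V" and E: "E \<subseteq> V \<times> V" and sym: "\<And>v w. (v, w) \<in> E \<Longrightarrow> (w, v) \<in> E"
    and irrefl: "\<And>v. (v, v) \<notin> E"
    and nonneg: "\<And>v. v \<in> V \<Longrightarrow> 0 \<le> x v" and unit: "(\<Sum>v\<in>V. (x v)^2) = 1"
    and max: "\<And>y. quad_form E y \<le> quad_form E x * (\<Sum>v\<in>V. (y v)^2)"
    and v: "v \<in> V"
  shows "(\<Sum>w\<in>E `` {v}. x w) = quad_form E x * x v"
proof -
  let ?q = "quad_form E x" and ?d = "\<Sum>w\<in>E `` {v}. x w"
  have fE: "finite E" using V E finite_subset by blast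
  have "2 * t * (?d - ?q * x v) \<le> ?q * t^2" for t
  proof -
    let ?y = "\<lambda>w. x w + (if w = v then t else 0)"
    have "quad_form E ?y = (\<Sum>p\<in>E. x (fst p) * x (snd p)
        + t * (if fst p = v then x (snd p) else 0) + t * (if snd p = v then x (fst p) else 0))"
      unfolding quad_form_def using irrefl by (intro sum.cong) (auto simp: algebra_simps)
    also have "\<dots> = ?q + t * ?d + t * ?d"
      unfolding sum.distrib sum_distrib_left[symmetric] sum_arcs_from[OF fE]
        sum_arcs_to[OF fE sym, simplified] by (simp add: quad_form_def)
    finally have Q: "quad_form E ?y = ?q + 2 * t * ?d" by simp
    have "(\<Sum>w\<in>V. (?y w)^2) = (\<Sum>w\<in>V. (x w)^2 + (if w = v then 2 * t * x w + t^2 else 0))"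
      by (intro sum.cong) (auto simp: power2_eq_square algebra_simps)
    also have "\<dots> = 1 + (2 * t * x v + t^2)" using V v by (simp add: sum.distrib unit)
    finally have N: "(\<Sum>w\<in>V. (?y w)^2) = 1 + (2 * t * x v + t^2)" .
    show ?thesis using max[of ?y] unfolding Q N by (simp add: algebra_simps)
  qed
  moreover have "0 \<le> ?q" unfolding quad_form_def using E nonneg by (intro sum_nonneg) auto
  ultimately have "?d - ?q * x v = 0" by (intro first_order_condition)
  then show ?thesis by simp
qed

lemma pair_graph_arcs:
  assumes "pair_graph G"
  shows "finite (pverts G)" "parcs G \<subseteq> pverts G \<times> pverts G"
    "\<And>v w. (v, w) \<in> parcs G \<Longrightarrow> (w, v) \<in> parcs G" "\<And>v. (v, v) \<notin> parcs G"
proof -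
  interpret pair_graph G by fact
  show "finite (pverts G)" by (rule pair_finite_verts)
  show "parcs G \<subseteq> pverts G \<times> pverts G" using in_arcsD1 in_arcsD2 by auto
  show "\<And>v w. (v, w) \<in> parcs G \<Longrightarrow> (w, v) \<in> parcs G"
    using pair_sym_arcs by (auto simp: symmetric_def dest: symD)
  show "\<And>v. (v, v) \<notin> parcs G" using pair_no_loops by force
qed

lemma finite_spectrum_adjacency: "finite (spectrum (adjacency_mat G))"
  by (rule card_finite_spectrum[of _ "card (pverts G)"]) (simp add: adjacency_mat_def)

lemma eigenvalue_le_spectral_radius:
  "eigenvalue (adjacency_mat G) k \<Longrightarrow> k \<le> graph_spectral_radius G"
  unfolding graph_spectral_radius_def
  by (intro Max_ge finite_spectrum_adjacency) (simp add: spectrum_def)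

text \<open>The maximum of the form is an eigenvalue by \<open>maximizer_eigen\<close>. An
  eigenvector for \<open>k\<close> has form \<open>k\<close> times its squared norm, so no
  eigenvalue exceeds that maximum.\<close>

lemma perron_vector:
  assumes G: "pair_graph G" and ne: "pverts G \<noteq> {}"
  obtains x where "\<And>v. v \<in> pverts G \<Longrightarrow> 0 \<le> x v" "\<exists>v\<in>pverts G. x v \<noteq> 0"
    "\<And>v. v \<in> pverts G \<Longrightarrow> (\<Sum>w\<in>parcs G `` {v}. x w) = graph_spectral_radius G * x v"
proof -
  let ?V = "pverts G" and ?E = "parcs G"
  note g = pair_graph_arcs[OF G]
  obtain x where x: "\<And>v. v \<in> ?V \<Longrightarrow> 0 \<le> x v" "(\<Sum>v\<in>?V. (x v)^2) = 1"
    "\<And>y. quad_form ?E y \<le> quad_form ?E x * (\<Sum>v\<in>?V. (y v)^2)"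
    using ex_nonneg_maximizer[OF g(1) ne g(2)] by blast
  have e: "(\<Sum>w\<in>?E `` {v}. x w) = quad_form ?E x * x v" if "v \<in> ?V" for v
    by (rule maximizer_eigen[OF g x that])
  have nz: "\<exists>v\<in>?V. x v \<noteq> 0"
  proof (rule ccontr)
    assume "\<not> ?thesis"
    then have "(\<Sum>v\<in>?V. (x v)^2) = 0" by (intro sum.neutral) auto
    then show False using x(2) by simp
  qed
  have eq: "graph_spectral_radius G = quad_form ?E x"
    unfolding graph_spectral_radius_def
  proof (rule Max_eqI[OF finite_spectrum_adjacency])
    show "quad_form ?E x \<in> spectrum (adjacency_mat G)"
      unfolding spectrum_def mem_Collect_eq eigenvalue_adjacency_mat_iff[OF G]
      using e nz by (auto simp: Image_singleton)
    fix k assume "k \<in> spectrum (adjacency_mat G)"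
    then obtain y where y: "\<exists>v\<in>?V. y v \<noteq> 0"
      "\<And>v. v \<in> ?V \<Longrightarrow> (\<Sum>w\<in>?E `` {v}. y w) = k * y v"
      unfolding spectrum_def mem_Collect_eq eigenvalue_adjacency_mat_iff[OF G] Image_singleton
      by blast
    have "0 < (\<Sum>v\<in>?V. (y v)^2)"
      using y(1) g(1) by (auto intro: sum_pos2)
    moreover have "k * (\<Sum>v\<in>?V. (y v)^2) \<le> quad_form ?E x * (\<Sum>v\<in>?V. (y v)^2)"
      using x(3)[of y] quad_form_eigen[OF g(1,2) y(2)] by simp
    ultimately show "k \<le> quad_form ?E x" by simp
  qed
  show thesis by (rule that[OF x(1) nz]) (simp_all add: eq e)
qed

section \<open>Spectral bounds from the extremal graph\<close>

text \<open>For \<open>m = a * b\<close> this cubic is the eigenvalue equation of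
  \<open>complete_bipartite_plus a b\<close>. Its left side is \<open>0\<close> at
  \<open>sqrt m\<close> and at least \<open>2 * b\<close> at
  \<open>sqrt m + 2 * b + 1\<close>.\<close>

lemma ex_plus_root:
  fixes m b :: real
  assumes "1 \<le> m" "0 < b"
  obtains r where "1 < r" "m \<le> r^2" "(r^2 - m) * (r - 1) = 2 * b"
proof -
  define f where "f r = (r^2 - m) * (r - 1)" for r
  let ?s = "sqrt m" and ?h = "2 * b + 1"
  have s: "1 \<le> ?s" "?s^2 = m" using assms by auto
  have "f ?s \<le> 2 * b" using assms by (simp add: f_def s(2))
  moreover have "2 * b \<le> f (?s + ?h)"
  proof -
    have "1 \<le> ?h^2" using assms by simp
    moreover have "0 \<le> 2 * ?s * ?h" using assms by (intro mult_nonneg_nonneg) auto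
    ultimately have "1 \<le> (?s + ?h)^2 - m" using s(2) by (simp only: power2_sum)
    then have "1 * (2 * b) \<le> ((?s + ?h)^2 - m) * (?s + ?h - 1)"
      using assms s(1) by (intro mult_mono) auto
    then show ?thesis by (simp add: f_def)
  qed
  moreover have "\<forall>r. ?s \<le> r \<and> r \<le> ?s + ?h \<longrightarrow> isCont f r"
    unfolding f_def by (intro allI impI continuous_intros)
  ultimately obtain r where r: "?s \<le> r" "f r = 2 * b"
    using IVT[of f ?s "2 * b" "?s + ?h"] assms by auto
  have "m \<le> r^2" using power_mono[OF r(1), of 2] s by auto
  moreover have "r \<noteq> 1" using r(2) assms by (auto simp: f_def)
  ultimately show thesis using that[of r] r s(1) by (simp add: f_def)
qed

text \<open>
  The eigenvector is constant on the three orbits of the automorphism group of \<open>K\<^sub>a\<^sub>,\<^sub>b\<^sup>+\<close>; solving the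
  resulting three equations for the values gives the ones below.
\<close>

lemma plus_eigenvalue:
  fixes r :: real
  assumes ab: "2 \<le> a" "1 \<le> b" and r: "1 < r" "(r^2 - real (a * b)) * (r - 1) = 2 * real b"
  shows "eigenvalue (adjacency_mat (complete_bipartite_plus a b)) r"
proof -
  let ?G = "complete_bipartite_plus a b"
  define x where "x v = (if v < 2 then real b * r else if v < a then real b * (r - 1) else r * (r - 1))"
    for v :: nat
  have B: "(\<Sum>w\<in>{a..<a + b}. x w) = real b * (r * (r - 1))"
    using ab by (simp add: x_def)
  have A: "(\<Sum>w\<in>{..<a}. x w) = 2 * (real b * r) + (real a - 2) * (real b * (r - 1))"
  proof -
    have "{..<a} = {..<2} \<union> {2..<a}" using ab by auto
    then have "(\<Sum>w\<in>{..<a}. x w) = (\<Sum>w\<in>{..<2}. x w) + (\<Sum>w\<in>{2..<a}. x w)"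
      by (metis finite_atLeastLessThan finite_lessThan ivl_disj_int_one(2) sum.union_disjoint)
    also have "(\<Sum>w\<in>{..<2}. x w) = 2 * (real b * r)" by (simp add: x_def)
    also have "(\<Sum>w\<in>{2..<a}. x w) = (real a - 2) * (real b * (r - 1))"
      using ab by (simp add: x_def of_nat_diff)
    finally show ?thesis .
  qed
  have "(\<Sum>w | (v, w) \<in> parcs ?G. x w) = r * x v" if v: "v \<in> pverts ?G" for v
  proof -
    consider "v = 0" | "v = 1" | "2 \<le> v" "v < a" | "a \<le> v" "v < a + b"
      using v by (fastforce simp: complete_bipartite_plus_def complete_bipartite_def)
    then show ?thesis
    proof cases
      case 1
      then have "{w. (v, w) \<in> parcs ?G} = insert 1 {a..<a + b}"
        using ab by (auto simp: complete_bipartite_plus_def complete_bipartite_def)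
      then show ?thesis using ab B 1 by (simp add: x_def algebra_simps)
    next
      case 2
      then have "{w. (v, w) \<in> parcs ?G} = insert 0 {a..<a + b}"
        using ab by (auto simp: complete_bipartite_plus_def complete_bipartite_def)
      then show ?thesis using ab B 2 by (simp add: x_def algebra_simps)
    next
      case 3
      then have "{w. (v, w) \<in> parcs ?G} = {a..<a + b}"
        by (auto simp: complete_bipartite_plus_def complete_bipartite_def)
      then show ?thesis using B 3 by (simp add: x_def algebra_simps)
    next
      case 4
      then have "{w. (v, w) \<in> parcs ?G} = {..<a}"
        using ab by (auto simp: complete_bipartite_plus_def complete_bipartite_def)
      moreover have "r * (r * (r - 1)) = 2 * (real b * r) + (real a - 2) * (real b * (r - 1))"
        using r(2) by (simp add: power2_eq_square algebra_simps)
      moreover have "x v = r * (r - 1)" using 4 ab by (simp add: x_def)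
      ultimately show ?thesis using A by simp
    qed
  qed
  moreover have "0 \<in> pverts ?G" "x 0 \<noteq> 0"
    using ab r(1) by (auto simp: complete_bipartite_plus_def complete_bipartite_def x_def)
  ultimately show ?thesis
    unfolding eigenvalue_adjacency_mat_iff[OF pair_graph_complete_bipartite_plus[OF ab(1)]] by blast
qed

text \<open>The root \<open>r\<close> is an eigenvalue, hence at most \<open>l\<close>, and the
  cubic increases from \<open>r\<close> on. This supplies the conditions on \<open>l\<close> in
  \<open>perron_graph\<close>.\<close>

lemma plus_spectral_radius:
  assumes "2 \<le> a" "1 \<le> b" "graph_spectral_radius (complete_bipartite_plus a b) \<le> l"
  shows "1 < l" "real (a * b) < l^2" "2 * real b \<le> (l^2 - real (a * b)) * (l - 1)"
proof -
  have "1 \<le> real (a * b)" using assms by (simp flip: of_nat_mult add: Suc_le_eq)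
  then obtain r where r: "1 < r" "real (a * b) \<le> r^2" "(r^2 - real (a * b)) * (r - 1) = 2 * real b"
    using ex_plus_root[of "real (a * b)" "real b"] assms(2) by auto
  have "r \<le> l"
    using eigenvalue_le_spectral_radius[OF plus_eigenvalue[OF assms(1,2) r(1,3)]] assms(3) by linarith
  then show "1 < l" using r(1) by simp
  have "r^2 \<le> l^2" using \<open>r \<le> l\<close> r(1) by (intro power_mono) auto
  then have "(r^2 - real (a * b)) * (r - 1) \<le> (l^2 - real (a * b)) * (l - 1)"
    using \<open>r \<le> l\<close> \<open>r^2 \<le> l^2\<close> r(1,2) by (intro mult_mono) linarith+
  then show *: "2 * real b \<le> (l^2 - real (a * b)) * (l - 1)" using r(3) by simp
  show "real (a * b) < l^2"
  proof (rule ccontr)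
    assume "\<not> ?thesis"
    then have "(l^2 - real (a * b)) * (l - 1) \<le> 0"
      using \<open>1 < l\<close> by (intro mult_nonpos_nonneg) auto
    then show False using * assms(2) by simp
  qed
qed

section \<open>Counting triangular edges\<close>

lemma card_symmetric_arcs:
  assumes fin: "finite R" and sym: "\<And>v w. (v, w) \<in> R \<Longrightarrow> (w, v) \<in> R" and irrefl: "\<And>v. (v, v) \<notin> R"
  shows "card R = 2 * card ((\<lambda>(v, w). {v, w}) ` R)"
proof -
  let ?f = "\<lambda>(v, w). {v, w}"
  have "card R = (\<Sum>e\<in>?f ` R. card {p \<in> R. ?f p = e})"
    using sum.image_gen[OF fin, of "\<lambda>_. 1 :: nat" ?f] by simp
  also have "\<dots> = (\<Sum>e\<in>?f ` R. 2)"
  proof (rule sum.cong[OF refl])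
    fix e assume "e \<in> ?f ` R"
    then obtain v w where vw: "(v, w) \<in> R" "e = {v, w}" by auto
    then have "{p \<in> R. ?f p = e} = {(v, w), (w, v)}"
      using sym by (auto simp: doubleton_eq_iff)
    moreover have "v \<noteq> w" using vw irrefl by auto
    ultimately show "card {p \<in> R. ?f p = e} = 2" by simp
  qed
  finally show ?thesis by simp
qed

lemma card_triangular_arcs:
  assumes "pair_graph G"
  shows "card {(v, w) \<in> parcs G. \<exists>z. (w, z) \<in> parcs G \<and> (z, v) \<in> parcs G}
    = 2 * card (triangular_edges G)"
proof -
  note g = pair_graph_arcs[OF assms]
  let ?R = "{(v, w) \<in> parcs G. \<exists>z. (w, z) \<in> parcs G \<and> (z, v) \<in> parcs G}"
  have "finite (parcs G)" using g(1,2) finite_subset by blast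
  then have "finite ?R" by (rule rev_finite_subset) auto
  then have "card ?R = 2 * card ((\<lambda>(v, w). {v, w}) ` ?R)"
    by (rule card_symmetric_arcs) (use g(3,4) in blast)+
  also have "(\<lambda>(v, w). {v, w}) ` ?R = triangular_edges G"
    by (auto simp: triangular_edges_def is_triangle_def image_iff; blast)
  finally show ?thesis .
qed

text \<open>Every triangle consists of the added edge and a vertex of the other part, so the
  triangular edges are the added one and those from its ends to that part.\<close>

lemma card_triangular_edges_plus:
  assumes ab: "2 \<le> a" "1 \<le> b"
  shows "card (triangular_edges (complete_bipartite_plus a b)) = 2 * b + 1"
proof -
  let ?G = "complete_bipartite_plus a b" and ?B = "{a..<a + b}"
  have mem: "(v, w) \<in> parcs ?G \<longleftrightarrow> v < a \<and> w \<in> ?B \<or> v \<in> ?B \<and> w < a \<or> v = 0 \<and> w = 1 \<or> v = 1 \<and> w = 0"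
    for v w by (auto simp: complete_bipartite_plus_def complete_bipartite_def)
  have "{(v, w) \<in> parcs ?G. \<exists>z. (w, z) \<in> parcs ?G \<and> (z, v) \<in> parcs ?G}
      = {0, 1} \<times> ?B \<union> ?B \<times> {0, 1} \<union> {(0, 1), (1, 0)}" (is "?L = ?R")
  proof
    show "?L \<subseteq> ?R" using ab unfolding mem by auto
    define L where "L = ?L"
    have "(0, w) \<in> L" "(w, 0) \<in> L" if "w \<in> ?B" for w
      using ab that unfolding L_def mem by (auto intro!: exI[of _ 1])
    moreover have "(1, w) \<in> L" "(w, 1) \<in> L" if "w \<in> ?B" for w
      using ab that unfolding L_def mem by (auto intro!: exI[of _ 0])
    moreover have "(0, 1) \<in> L" "(1, 0) \<in> L"
      using ab unfolding L_def mem by (auto intro!: exI[of _ a])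
    ultimately have "?R \<subseteq> L" by blast
    then show "?R \<subseteq> ?L" unfolding L_def .
  qed
  moreover have "card ?R = card ({0, 1 :: nat} \<times> ?B) + card (?B \<times> {0, 1 :: nat}) + card {(0, 1), (1, 0) :: nat \<times> nat}"
    using ab by (subst card_Un_disjoint card_Un_disjoint; auto)+
  ultimately show ?thesis
    using card_triangular_arcs[OF pair_graph_complete_bipartite_plus[OF ab(1)], of b]
    by (simp add: card_cartesian_product)
qed

section \<open>Isomorphisms\<close>

text \<open>An isomorphism carries separate maps for vertices, arcs, tails and heads. Arcs of both
  graphs are pairs with ends \<open>fst\<close> and \<open>snd\<close>, so the vertex map determines
  the arc map.\<close>

lemma digraph_isoD:
  assumes "digraph_iso (with_proj G) (with_proj H)"
  obtains h where "inj_on h (pverts G)" "parcs G \<subseteq> pverts G \<times> pverts G"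
    "parcs H = map_prod h h ` parcs G"
proof -
  obtain f where f: "pre_digraph.digraph_isomorphism (with_proj G) f"
    "with_proj H = app_iso f (with_proj G)"
    using assms unfolding digraph_iso_def by blast
  have ht: "iso_tail f = fst" "iso_head f = snd"
    using f(2) by (auto simp: with_proj_def app_iso_def)
  have "parcs H = iso_arcs f ` parcs G" using f(2) by (auto simp: with_proj_def app_iso_def)
  also have "\<dots> = map_prod (iso_verts f) (iso_verts f) ` parcs G"
  proof (rule image_cong[OF refl])
    fix e assume "e \<in> parcs G"
    then show "iso_arcs f e = map_prod (iso_verts f) (iso_verts f) e"
      using f(1) ht unfolding pre_digraph.digraph_isomorphism_def
      by (cases e) (auto simp: prod_eq_iff)
  qed
  finally have *: "parcs H = map_prod (iso_verts f) (iso_verts f) ` parcs G" .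
  have "inj_on (iso_verts f) (pverts G)" "wf_digraph (with_proj G)"
    using f(1) unfolding pre_digraph.digraph_isomorphism_def by auto
  moreover from this(2) have "parcs G \<subseteq> pverts G \<times> pverts G"
    by (auto dest: wf_digraph.head_in_verts wf_digraph.tail_in_verts)
  ultimately show thesis using * by (intro that)
qed

lemma card_triangular_edges_iso:
  assumes "digraph_iso (with_proj G) (with_proj H)"
  shows "card (triangular_edges H) = card (triangular_edges G)"
proof -
  obtain h where h: "inj_on h (pverts G)" and sub: "parcs G \<subseteq> pverts G \<times> pverts G"
    and H: "parcs H = map_prod h h ` parcs G"
    using digraph_isoD[OF assms] .
  have mem: "(h v, h w) \<in> parcs H \<longleftrightarrow> (v, w) \<in> parcs G" if "v \<in> pverts G" "w \<in> pverts G" for v w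
    using that h sub unfolding H by (auto dest: inj_onD)
  have "triangular_edges H = (\<lambda>e. h ` e) ` triangular_edges G"
  proof (intro equalityI subsetI)
    fix e assume "e \<in> triangular_edges H"
    then obtain v w z where e: "e = {v, w}" "(v, w) \<in> parcs H" "(w, z) \<in> parcs H" "(z, v) \<in> parcs H"
      by (auto simp: triangular_edges_def is_triangle_def)
    then obtain v' w' z' where "(v', w') \<in> parcs G" "v = h v'" "w = h w'" "z = h z'" "z' \<in> pverts G"
      using sub unfolding H by fastforce
    moreover from this have "(w', z') \<in> parcs G" "(z', v') \<in> parcs G"
      using e mem sub by blast+
    ultimately show "e \<in> (\<lambda>e. h ` e) ` triangular_edges G"
      using e(1) unfolding triangular_edges_def is_triangle_def
      by (intro image_eqI[of _ _ "{v', w'}"]) auto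
  next
    fix e assume "e \<in> (\<lambda>e. h ` e) ` triangular_edges G"
    then obtain v w z where "e = {h v, h w}" "(v, w) \<in> parcs G" "(w, z) \<in> parcs G" "(z, v) \<in> parcs G"
      by (auto simp: triangular_edges_def is_triangle_def)
    then show "e \<in> triangular_edges H"
      using sub mem unfolding triangular_edges_def is_triangle_def by blast
  qed
  moreover have "inj_on (\<lambda>e. h ` e) (triangular_edges G)"
    using h sub by (intro inj_on_image[OF inj_on_subset[OF h]])
      (auto simp: triangular_edges_def)
  ultimately show ?thesis by (simp add: card_image)
qed

lemma digraph_isoI:
  assumes "pair_graph G" "bij_betw h (pverts G) (pverts H)" "parcs H = map_prod h h ` parcs G"
  shows "digraph_iso (with_proj G) (with_proj H)"
proof -
  interpret pair_graph G by fact
  let ?f = "\<lparr>iso_verts = h, iso_arcs = map_prod h h, iso_head = snd, iso_tail = fst\<rparr>"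
  have inj: "inj_on h (pverts G)" using assms(2) by (rule bij_betw_imp_inj_on)
  have "inj_on (map_prod h h) (parcs G)"
    using map_prod_inj_on[OF inj inj] pair_graph_arcs(2)[OF assms(1)] by (rule inj_on_subset)
  then have "pre_digraph.digraph_isomorphism (with_proj G) ?f"
    using inj wf_digraph_axioms unfolding pre_digraph.digraph_isomorphism_def by auto
  moreover have "with_proj H = app_iso ?f (with_proj G)"
    using assms(2,3) by (simp add: with_proj_def app_iso_def bij_betw_def)
  ultimately show ?thesis unfolding digraph_iso_def by blast
qed

lemma plus_partition_iso:
  assumes G: "pair_graph G" and AB: "A \<union> B = pverts G" "A \<inter> B = {}"
    and pq: "p \<in> A" "q \<in> A" "p \<noteq> q" and card: "card A = a" "card B = b"
    and E: "parcs G = A \<times> B \<union> B \<times> A \<union> {(p, q), (q, p)}"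
  shows "digraph_iso (with_proj G) (with_proj (complete_bipartite_plus a b))"
proof -
  have fin: "finite A" "finite B" using pair_graph_arcs(1)[OF G] AB(1) by (metis finite_Un)+
  have a: "2 \<le> a" using card_mono[OF fin(1), of "{p, q}"] pq card(1) by simp
  have "card (A - {p, q}) = card {2..<a}" using pq card fin by (simp add: card_Diff_subset)
  then obtain f where f: "bij_betw f (A - {p, q}) {2..<a}"
    using finite_same_card_bij[of "A - {p, q}" "{2..<a}"] fin by auto
  obtain g where g: "bij_betw g B {a..<a + b}"
    using finite_same_card_bij[of B "{a..<a + b}"] fin card by auto
  \<comment> \<open>The inner edge goes to \<open>0\<close> and \<open>1\<close>, the rest of
    \<open>A\<close> and all of \<open>B\<close> to the remaining intervals. Injectivity follows
    since \<open>h\<close> maps onto a set of the same size.\<close>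
  define h where "h v = (if v = p then 0 else if v = q then 1 else if v \<in> A then f v else g v)" for v
  have hp: "h p = 0" "h q = 1" using pq by (auto simp: h_def)
  have hA: "h ` A = {..<a}"
  proof -
    have "h ` (A - {p, q}) = f ` (A - {p, q})" by (intro image_cong) (auto simp: h_def)
    then have "h ` (A - {p, q}) = {2..<a}" using f by (simp add: bij_betw_def)
    moreover have "A = insert p (insert q (A - {p, q}))" using pq by auto
    ultimately have "h ` A = insert 0 (insert 1 {2..<a})" using hp by (metis image_insert)
    then show ?thesis using a by auto
  qed
  have hB: "h ` B = {a..<a + b}"
  proof -
    have "h ` B = g ` B" using AB pq by (intro image_cong) (auto simp: h_def)
    then show ?thesis using g by (simp add: bij_betw_def)
  qed
  have "h ` pverts G = {..<a + b}" unfolding AB(1)[symmetric] image_Un hA hB by auto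
  moreover have "card (pverts G) = a + b"
    using card_Un_disjoint[OF fin AB(2)] AB(1) card by simp
  ultimately have "inj_on h (pverts G)"
    using pair_graph_arcs(1)[OF G] by (intro eq_card_imp_inj_on) auto
  show ?thesis
  proof (rule digraph_isoI[OF G])
    show "bij_betw h (pverts G) (pverts (complete_bipartite_plus a b))"
      using \<open>inj_on h (pverts G)\<close> \<open>h ` pverts G = {..<a + b}\<close>
      by (simp add: bij_betw_def complete_bipartite_plus_def complete_bipartite_def)
    have "map_prod h h ` parcs G = h ` A \<times> h ` B \<union> h ` B \<times> h ` A \<union> {(h p, h q), (h q, h p)}"
      unfolding E by (simp add: image_Un map_prod_surj_on[OF refl refl])
    then show "parcs (complete_bipartite_plus a b) = map_prod h h ` parcs G"
      by (simp add: hA hB hp complete_bipartite_plus_def complete_bipartite_def)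
  qed
qed

section \<open>Conclusion\<close>

lemma few_triangular_edges_iso_plus:
  fixes G :: "'a pair_pre_digraph"
  assumes G: "pair_graph G" and n: "card (pverts G) = n" "5432 \<le> n"
    and l: "graph_spectral_radius (complete_bipartite_plus (n - n div 2) (n div 2))
      \<le> graph_spectral_radius G"
    and few: "card (triangular_edges G) \<le> 2 * (n div 2) + 1"
  shows "digraph_iso (with_proj G) (with_proj (complete_bipartite_plus (n - n div 2) (n div 2)))"
proof -
  let ?V = "pverts G" and ?E = "parcs G" and ?l = "graph_spectral_radius G"
  note g = pair_graph_arcs[OF G]
  have ab: "2 \<le> n - n div 2" "1 \<le> n div 2" using n(2) by linarith+
  have ne: "?V \<noteq> {}" using n by auto
  obtain y where y: "\<And>v. v \<in> ?V \<Longrightarrow> 0 \<le> y v" "\<exists>v\<in>?V. y v \<noteq> 0"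
    "\<And>v. v \<in> ?V \<Longrightarrow> (\<Sum>w\<in>?E `` {v}. y w) = ?l * y v"
    using perron_vector[OF G ne] by blast
  have "Max (y ` ?V) \<in> y ` ?V" using g(1) ne by (intro Max_in) auto
  then obtain u where u: "u \<in> ?V" "Max (y ` ?V) = y u" by auto
  have le: "y v \<le> y u" if "v \<in> ?V" for v
    unfolding u(2)[symmetric] using that g(1) by (intro Max_ge) auto
  obtain v where "v \<in> ?V" "y v \<noteq> 0" using y(2) by blast
  then have pos: "0 < y u" using y(1)[of v] le[of v] by linarith
  note K = plus_spectral_radius[OF ab l]
  interpret perron_graph ?V ?E "\<lambda>v. y v / y u" ?l u n "n div 2"
  proof
    show "?l * (y v / y u) = (\<Sum>w\<in>?E `` {v}. y w / y u)" if "v \<in> ?V" for v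
      using y(3)[OF that] by (simp add: sum_divide_distrib[symmetric])
    show "card {(v, w) \<in> ?E. \<exists>z. (w, z) \<in> ?E \<and> (z, v) \<in> ?E} \<le> 4 * (n div 2) + 2"
      using few by (simp add: card_triangular_arcs[OF G])
  qed (use g u n y(1) le pos K in auto)
  obtain A B p q where P: "A \<union> B = ?V" "A \<inter> B = {}" "p \<in> A" "q \<in> A" "p \<noteq> q"
    "card B = n div 2" "?E = A \<times> B \<union> B \<times> A \<union> {(p, q), (q, p)}"
    using ex_plus_partition by blast
  have "finite A" "finite B" using g(1) P(1) by (metis finite_Un)+
  then have "card A = n - n div 2"
    using card_Un_disjoint[of A B] P(1,2,6) n(1) by simp
  then show ?thesis by (rule plus_partition_iso[OF G P(1-5) _ P(6,7)])
qed

theorem theorem2p2: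
  fixes G :: "'a pair_pre_digraph" and n :: nat
  assumes "pair_graph G"
    and "card (pverts G) = n"
    and "n \<ge> 5432"
    and "graph_spectral_radius G
      \<ge> graph_spectral_radius (complete_bipartite_plus (nat \<lceil>real n / 2\<rceil>) (nat \<lfloor>real n / 2\<rfloor>))"
  shows "card (triangular_edges G) \<ge> 2 * nat \<lfloor>real n / 2\<rfloor> + 1 \<and>
    (card (triangular_edges G) = 2 * nat \<lfloor>real n / 2\<rfloor> + 1 \<longleftrightarrow>
      digraph_iso (with_proj G)
        (with_proj (complete_bipartite_plus (nat \<lceil>real n / 2\<rceil>) (nat \<lfloor>real n / 2\<rfloor>))))"
proof -
  have b: "nat \<lfloor>real n / 2\<rfloor> = n div 2" by (simp add: floor_divide_of_nat_eq[of n 2, simplified])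
  have a: "nat \<lceil>real n / 2\<rceil> = n - n div 2"
    by linarith
  have iso: "digraph_iso (with_proj G) (with_proj (complete_bipartite_plus (n - n div 2) (n div 2)))"
    if "card (triangular_edges G) \<le> 2 * (n div 2) + 1"
    using few_triangular_edges_iso_plus[OF assms(1-3) _ that] assms(4) unfolding a b by simp
  have "card (triangular_edges G) = 2 * (n div 2) + 1"
    if "digraph_iso (with_proj G) (with_proj (complete_bipartite_plus (n - n div 2) (n div 2)))"
    using card_triangular_edges_iso[OF that] card_triangular_edges_plus[of "n - n div 2" "n div 2"]
      assms(3) by simp
  \<comment> \<open>A count of at most \<open>2 * b + 1\<close>, with \<open>b = n div 2\<close>,
    forces an isomorphism and hence equality, so smaller counts do not occur.\<close>
  with iso show ?thesis unfolding a b by (metis nat_le_linear order_refl)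
qed

end
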